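(* Let $X,Y$ be Banach spaces. Every super-Tauberian operator $T\in\mathcal L(X,Y)$ is strongly Tauberian.
   Context: $T$ is Tauberian if $T^{**}(X^{**}\setminus X)\subset Y^{**}\setminus Y$. For a non-trivial ultrafilter $\mathcal U$ on $\mathbb N$, $X_{\mathcal U}=\ell^\infty(X)/\{(x_j):\lim_{j\in\mathcal U}\|x_j\|=0\}$ with $\|[(x_j)]\|=\lim_{j\in\mathcal U}\|x_j\|$, and $T_{\mathcal U}[(x_j)]=[(Tx_j)]$; $T$ is super-Tauberian if $T_{\mathcal U}$ is Tauberian (independent of $\mathcal U$). $T$ is strongly Tauberian if the induced operator $\widetilde T:X^{**}/X\to Y^{**}/Y$, $\widetilde T(x^{**}+X)=T^{**}x^{**}+Y$, is an (into) isomorphism. *)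

theory Defs
  imports "HOL-Analysis.Analysis"
begin

text \<open>Generic framework: a (semi)normed space given by a carrier V (a linear subspace of
  some ambient space with addition ad and real scaling sc) and a seminorm p.
  The associated normed space is V modulo the null space of p.  Duals and biduals are
  represented by extensional real-valued functions (zero outside their domain).\<close>

definition sdual :: "'v set \<Rightarrow> ('v \<Rightarrow> 'v \<Rightarrow> 'v) \<Rightarrow> (real \<Rightarrow> 'v \<Rightarrow> 'v) \<Rightarrow> ('v \<Rightarrow> real)
    \<Rightarrow> ('v \<Rightarrow> real) set" where
  "sdual V ad sc p = {f.
     (\<forall>x\<in>V. \<forall>y\<in>V. f (ad x y) = f x + f y) \<and>
     (\<forall>c. \<forall>x\<in>V. f (sc c x) = c * f x) \<and>
     (\<exists>C. \<forall>x\<in>V. \<bar>f x\<bar> \<le> C * p x) \<and>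
     (\<forall>x. x \<notin> V \<longrightarrow> f x = 0)}"

definition sdnorm :: "'v set \<Rightarrow> ('v \<Rightarrow> real) \<Rightarrow> ('v \<Rightarrow> real) \<Rightarrow> real" where
  "sdnorm V p f = (SUP x\<in>{x\<in>V. p x \<le> 1}. \<bar>f x\<bar>)"

definition sbidual :: "'v set \<Rightarrow> ('v \<Rightarrow> 'v \<Rightarrow> 'v) \<Rightarrow> (real \<Rightarrow> 'v \<Rightarrow> 'v) \<Rightarrow> ('v \<Rightarrow> real)
    \<Rightarrow> (('v \<Rightarrow> real) \<Rightarrow> real) set" where
  "sbidual V ad sc p = {\<Phi>.
     (\<forall>f\<in>sdual V ad sc p. \<forall>g\<in>sdual V ad sc p. \<Phi> (\<lambda>x. f x + g x) = \<Phi> f + \<Phi> g) \<and>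
     (\<forall>c. \<forall>f\<in>sdual V ad sc p. \<Phi> (\<lambda>x. c * f x) = c * \<Phi> f) \<and>
     (\<exists>C. \<forall>f\<in>sdual V ad sc p. \<bar>\<Phi> f\<bar> \<le> C * sdnorm V p f) \<and>
     (\<forall>f. f \<notin> sdual V ad sc p \<longrightarrow> \<Phi> f = 0)}"

text \<open>Norm on the bidual.\<close>
definition sbdnorm :: "'v set \<Rightarrow> ('v \<Rightarrow> 'v \<Rightarrow> 'v) \<Rightarrow> (real \<Rightarrow> 'v \<Rightarrow> 'v) \<Rightarrow> ('v \<Rightarrow> real)
    \<Rightarrow> (('v \<Rightarrow> real) \<Rightarrow> real) \<Rightarrow> real" where
  "sbdnorm V ad sc p \<Phi> = (SUP f\<in>{f\<in>sdual V ad sc p. sdnorm V p f \<le> 1}. \<bar>\<Phi> f\<bar>)"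

text \<open>Canonical embedding into the bidual.\<close>
definition scanon :: "'v set \<Rightarrow> ('v \<Rightarrow> 'v \<Rightarrow> 'v) \<Rightarrow> (real \<Rightarrow> 'v \<Rightarrow> 'v) \<Rightarrow> ('v \<Rightarrow> real)
    \<Rightarrow> 'v \<Rightarrow> (('v \<Rightarrow> real) \<Rightarrow> real)" where
  "scanon V ad sc p x = (\<lambda>f. if f \<in> sdual V ad sc p then f x else 0)"

text \<open>Second adjoint T** of T : V \<rightarrow> W.\<close>
definition sbiadj :: "'v set \<Rightarrow> ('v \<Rightarrow> 'v \<Rightarrow> 'v) \<Rightarrow> (real \<Rightarrow> 'v \<Rightarrow> 'v) \<Rightarrow> ('v \<Rightarrow> real)
    \<Rightarrow> 'w set \<Rightarrow> ('w \<Rightarrow> 'w \<Rightarrow> 'w) \<Rightarrow> (real \<Rightarrow> 'w \<Rightarrow> 'w) \<Rightarrow> ('w \<Rightarrow> real)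
    \<Rightarrow> ('v \<Rightarrow> 'w) \<Rightarrow> (('v \<Rightarrow> real) \<Rightarrow> real) \<Rightarrow> (('w \<Rightarrow> real) \<Rightarrow> real)" where
  "sbiadj V ad sc p W ad' sc' q T \<Phi> =
     (\<lambda>g. if g \<in> sdual W ad' sc' q then \<Phi> (\<lambda>x. if x \<in> V then g (T x) else 0) else 0)"

text \<open>Tauberian: T**(X** \ X) \<subseteq> Y** \ Y.\<close>
definition stauberian where
  "stauberian V ad sc p W ad' sc' q T \<longleftrightarrow>
     (\<forall>\<Phi>\<in>sbidual V ad sc p. \<Phi> \<notin> scanon V ad sc p ` V \<longrightarrow>
        sbiadj V ad sc p W ad' sc' q T \<Phi> \<notin> scanon W ad' sc' q ` W)"

text \<open>Strongly Tauberian: the induced map X**/X \<rightarrow> Y**/Y, with quotient norms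
  (distance to the canonical image), is bounded below, i.e. an into isomorphism.\<close>
definition sstrongly_tauberian where
  "sstrongly_tauberian V ad sc p W ad' sc' q T \<longleftrightarrow>
     (\<exists>c>0. \<forall>\<Phi>\<in>sbidual V ad sc p.
        c * (INF x\<in>V. sbdnorm V ad sc p (\<lambda>f. \<Phi> f - scanon V ad sc p x f))
          \<le> (INF y\<in>W. sbdnorm W ad' sc' q
                 (\<lambda>g. sbiadj V ad sc p W ad' sc' q T \<Phi> g - scanon W ad' sc' q y g)))"

text \<open>Instances for operators between Banach spaces.\<close>
definition tauberian :: "('a::real_normed_vector \<Rightarrow> 'b::real_normed_vector) \<Rightarrow> bool" where
  "tauberian T \<longleftrightarrow> stauberian UNIV (+) (*\<^sub>R) norm UNIV (+) (*\<^sub>R) norm T"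

definition strongly_tauberian :: "('a::real_normed_vector \<Rightarrow> 'b::real_normed_vector) \<Rightarrow> bool" where
  "strongly_tauberian T \<longleftrightarrow> sstrongly_tauberian UNIV (+) (*\<^sub>R) norm UNIV (+) (*\<^sub>R) norm T"

text \<open>Non-trivial (free) ultrafilters on the natural numbers.\<close>
definition free_ultrafilter_nat :: "nat filter \<Rightarrow> bool" where
  "free_ultrafilter_nat U \<longleftrightarrow> U \<noteq> bot \<and>
     (\<forall>A. eventually (\<lambda>j. j \<in> A) U \<or> eventually (\<lambda>j. j \<notin> A) U) \<and>
     (\<forall>n. \<not> eventually (\<lambda>j. j = n) U)"

text \<open>Ultrapower X_U: \<ell>\<infinity>(X) with seminorm lim_U \<parallel>x_j\<parallel>; quotienting by its null space
  gives X_U.\<close>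
definition linf :: "(nat \<Rightarrow> 'a::real_normed_vector) set" where
  "linf = {x. bounded (range x)}"

definition unorm :: "nat filter \<Rightarrow> (nat \<Rightarrow> 'a::real_normed_vector) \<Rightarrow> real" where
  "unorm U x = Lim U (\<lambda>j. norm (x j))"

definition seq_add :: "(nat \<Rightarrow> 'a::real_normed_vector) \<Rightarrow> (nat \<Rightarrow> 'a) \<Rightarrow> (nat \<Rightarrow> 'a)" where
  "seq_add x y = (\<lambda>j. x j + y j)"

definition seq_scale :: "real \<Rightarrow> (nat \<Rightarrow> 'a::real_normed_vector) \<Rightarrow> (nat \<Rightarrow> 'a)" where
  "seq_scale c x = (\<lambda>j. c *\<^sub>R x j)"

text \<open>T_U [(x_j)] = [(T x_j)] is Tauberian.\<close>
definition super_tauberian_wrt ::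
    "nat filter \<Rightarrow> ('a::real_normed_vector \<Rightarrow> 'b::real_normed_vector) \<Rightarrow> bool" where
  "super_tauberian_wrt U T \<longleftrightarrow>
     stauberian linf seq_add seq_scale (unorm U) linf seq_add seq_scale (unorm U) (\<lambda>x j. T (x j))"

end

theory Submission
  imports Defs "HOL-Library.Function_Algebras"
begin

text \<open>
  Suppose \<open>T\<close> is not strongly Tauberian. Normalising, one finds for each \<open>j\<close> an element
  \<open>\<Phi>\<^sub>j\<close> of \<open>X\<^sup>*\<^sup>*\<close> of norm at most \<open>2\<close> and distance more than \<open>1/2\<close> from \<open>X\<close> such that
  \<open>T\<^sup>*\<^sup>*\<Phi>\<^sub>j\<close> lies within \<open>1/(j+1)\<close> of a point \<open>w\<^sub>j\<close> of \<open>Y\<close>. A Hahn--Banach separation argument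
  (a local form of Goldstine's theorem for the pair \<open>(\<Phi>\<^sub>j, T\<^sup>*\<^sup>*\<Phi>\<^sub>j)\<close>) approximates \<open>\<Phi>\<^sub>j\<close>
  on any given functional by points \<open>x\<close> with \<open>\<parallel>x\<parallel> \<le> 3\<close> and \<open>\<parallel>T x - w\<^sub>j\<parallel> \<le> 2/(j+1)\<close>.
  Feeding these approximants into the ultrapower shows that
  \<open>ulimit g + T\<^sub>U\<^sup>* h \<mapsto> lim\<^sub>U \<Phi>\<^sub>j(g\<^sub>j) + h [w\<^sub>j]\<close> is dominated by three times the norm on
  \<open>X\<^sub>U\<^sup>*\<close>; a second application of Hahn--Banach extends it to \<open>\<Psi> \<in> X\<^sub>U\<^sup>*\<^sup>*\<close>. Then
  \<open>T\<^sub>U\<^sup>*\<^sup>*\<Psi> = [w\<^sub>j] \<in> Y\<^sub>U\<close>, whereas \<open>\<Psi>\<close> keeps distance \<open>1/2\<close> from \<open>X\<^sub>U\<close>: so \<open>T\<^sub>U\<close> is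
  not Tauberian.
\<close>

section \<open>The Hahn--Banach extension theorem\<close>

definition linear_on :: "'v::real_vector set \<Rightarrow> ('v \<Rightarrow> 'w::real_vector) \<Rightarrow> bool" where
  "linear_on E f \<longleftrightarrow>
     (\<forall>x \<in> E. \<forall>y \<in> E. f (x + y) = f x + f y) \<and> (\<forall>c. \<forall>x \<in> E. f (c *\<^sub>R x) = c *\<^sub>R f x)"

definition sublinear_on :: "'v::real_vector set \<Rightarrow> ('v \<Rightarrow> real) \<Rightarrow> bool" where
  "sublinear_on E p \<longleftrightarrow>
     (\<forall>x \<in> E. \<forall>y \<in> E. p (x + y) \<le> p x + p y) \<and> (\<forall>c\<ge>0. \<forall>x \<in> E. p (c *\<^sub>R x) = c * p x)"

lemma linear_onD:
  assumes "linear_on E f" "x \<in> E" "y \<in> E"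
  shows "f (x + y) = f x + f y" and "f (c *\<^sub>R x) = c *\<^sub>R f x"
  using assms unfolding linear_on_def by auto

lemma linear_on_real_scale:
  "linear_on E f \<Longrightarrow> x \<in> E \<Longrightarrow> f (c *\<^sub>R x) = c * (f x :: real)"
  unfolding linear_on_def by simp

lemma linear_on_diff:
  assumes "linear_on E f" "subspace E" "x \<in> E" "y \<in> E"
  shows "f (x - y) = f x - f y"
proof -
  have "f (x + (-1) *\<^sub>R y) = f x + (-1) *\<^sub>R f y"
    using assms linear_onD[OF assms(1)] by (simp only: subspace_scale)
  then show ?thesis by simp
qed

lemma linear_on_zero: "linear_on E f \<Longrightarrow> subspace E \<Longrightarrow> f 0 = 0"
  using linear_onD(2)[of E f 0 0 0] by (simp add: subspace_0)

lemma linear_on_Times: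
  assumes "linear_on A f" "linear_on B g"
  shows "linear_on (A \<times> B) (\<lambda>z. f (fst z) + g (snd z))"
  using assms unfolding linear_on_def by (auto simp: scaleR_add_right)

lemma sublinear_onD:
  assumes "sublinear_on E p" "x \<in> E"
  shows "y \<in> E \<Longrightarrow> p (x + y) \<le> p x + p y" and "c \<ge> 0 \<Longrightarrow> p (c *\<^sub>R x) = c * p x"
  using assms unfolding sublinear_on_def by auto

lemma sublinear_on_scale: "sublinear_on E p \<Longrightarrow> c \<ge> 0 \<Longrightarrow> sublinear_on E (\<lambda>x. c * p x)"
  unfolding sublinear_on_def by (simp add: distrib_left[symmetric] mult_left_mono mult.left_commute)

text \<open>Partial extensions in the Zorn argument are represented by their graphs.\<close>

definition dominated_linear_graph ::
    "'v::real_vector set \<Rightarrow> 'v set \<Rightarrow> ('v \<Rightarrow> real) \<Rightarrow> ('v \<Rightarrow> real) \<Rightarrow> ('v \<times> real) set \<Rightarrow> bool"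
  where
  "dominated_linear_graph E M phi p S \<longleftrightarrow>
     (\<forall>x v w. (x, v) \<in> S \<longrightarrow> (x, w) \<in> S \<longrightarrow> v = w) \<and> fst ` S \<subseteq> E \<and>
     (\<forall>x \<in> M. (x, phi x) \<in> S) \<and> (\<forall>x v. (x, v) \<in> S \<longrightarrow> v \<le> p x) \<and>
     (\<forall>x v y u. (x, v) \<in> S \<longrightarrow> (y, u) \<in> S \<longrightarrow> (x + y, v + u) \<in> S) \<and>
     (\<forall>c x v. (x, v) \<in> S \<longrightarrow> (c *\<^sub>R x, c * v) \<in> S)"

lemma dominated_linear_graphD:
  assumes "dominated_linear_graph E M phi p S"
  shows "(x, v) \<in> S \<Longrightarrow> (x, w) \<in> S \<Longrightarrow> v = w"
    and "(x, v) \<in> S \<Longrightarrow> x \<in> E"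
    and "x \<in> M \<Longrightarrow> (x, phi x) \<in> S"
    and "(x, v) \<in> S \<Longrightarrow> v \<le> p x"
    and "(x, v) \<in> S \<Longrightarrow> (y, u) \<in> S \<Longrightarrow> (x + y, v + u) \<in> S"
    and "(x, v) \<in> S \<Longrightarrow> (c *\<^sub>R x, c * v) \<in> S"
  using assms unfolding dominated_linear_graph_def by (force simp: image_subset_iff)+

lemma dominated_linear_graph_of_functional:
  assumes M: "subspace M" "M \<subseteq> E" and phi: "linear_on M phi"
    and dom: "\<And>x. x \<in> M \<Longrightarrow> phi x \<le> p x"
  shows "dominated_linear_graph E M phi p {(x, phi x) | x. x \<in> M}"
  unfolding dominated_linear_graph_def
proof (intro conjI allI impI)
  fix x v y u assume "(x, v) \<in> {(x, phi x) | x. x \<in> M}" "(y, u) \<in> {(x, phi x) | x. x \<in> M}"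
  then show "(x + y, v + u) \<in> {(x, phi x) | x. x \<in> M}"
    using M(1) linear_onD(1)[OF phi] by (auto simp: subspace_add)
next
  fix c x v assume "(x, v) \<in> {(x, phi x) | x. x \<in> M}"
  then show "(c *\<^sub>R x, c * v) \<in> {(x, phi x) | x. x \<in> M}"
    using M(1) linear_on_real_scale[OF phi] by (auto simp: subspace_scale)
qed (use M(2) dom in auto)

lemma dominated_linear_graph_Union:
  assumes C: "C \<noteq> {}" "chain\<^sub>\<subseteq> C" "\<And>S. S \<in> C \<Longrightarrow> dominated_linear_graph E M phi p S"
  shows "dominated_linear_graph E M phi p (\<Union>C)"
proof -
  have common: "\<exists>S \<in> C. a \<in> S \<and> b \<in> S" if "a \<in> \<Union>C" "b \<in> \<Union>C" for a b
    using that C(2) unfolding chain_subset_def by blast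
  show ?thesis
    unfolding dominated_linear_graph_def
  proof (intro conjI allI impI)
    fix x v w assume "(x, v) \<in> \<Union>C" "(x, w) \<in> \<Union>C"
    then show "v = w" using common C(3) unfolding dominated_linear_graph_def by metis
  next
    fix x v y u assume "(x, v) \<in> \<Union>C" "(y, u) \<in> \<Union>C"
    then obtain S where "S \<in> C" "(x, v) \<in> S" "(y, u) \<in> S" using common by blast
    then show "(x + y, v + u) \<in> \<Union>C" using C(3) unfolding dominated_linear_graph_def by blast
  next
    obtain S where "S \<in> C" using C(1) by blast
    then show "\<forall>x \<in> M. (x, phi x) \<in> \<Union>C" using C(3) unfolding dominated_linear_graph_def by blast
  qed (use C(3) in \<open>unfold dominated_linear_graph_def, blast+\<close>)
qed

text \<open>The value at the new direction is squeezed between the bounds that domination forces.\<close>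

lemma dominated_linear_graph_value:
  assumes S: "dominated_linear_graph E M phi p S" and "subspace E" and p: "sublinear_on E p"
    and S00: "(0, 0) \<in> S" and x0: "x0 \<in> E"
  obtains c where "\<And>z v. (z, v) \<in> S \<Longrightarrow> v - p (z - x0) \<le> c"
    and "\<And>z v. (z, v) \<in> S \<Longrightarrow> c \<le> p (z + x0) - v"
proof -
  note SE = dominated_linear_graphD(2)[OF S] and Sdom = dominated_linear_graphD(4)[OF S]
    and Sadd = dominated_linear_graphD(5)[OF S]
  have gap: "v - p (z - x0) \<le> p (z' + x0) - v'" if "(z, v) \<in> S" "(z', v') \<in> S" for z v z' v'
  proof -
    have "p ((z - x0) + (z' + x0)) \<le> p (z - x0) + p (z' + x0)"
      by (rule sublinear_onD(1)[OF p])
        (use SE that x0 \<open>subspace E\<close> in \<open>simp_all add: subspace_add subspace_diff\<close>)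
    then show ?thesis using Sdom[OF Sadd[OF that]] by simp
  qed
  have bdd: "bdd_above ((\<lambda>(z, v). v - p (z - x0)) ` S)"
    using gap[OF _ S00] by (auto intro!: bdd_aboveI2)
  show ?thesis
  proof (rule that)
    show "v - p (z - x0) \<le> (SUP (z, v) \<in> S. v - p (z - x0))" if "(z, v) \<in> S" for z v
      using cSUP_upper[OF that bdd] by simp
    show "(SUP (z, v) \<in> S. v - p (z - x0)) \<le> p (z + x0) - v" if "(z, v) \<in> S" for z v
      using S00 gap[OF _ that] by (force intro!: cSUP_least)
  qed
qed

lemma dominated_linear_graph_value_le:
  assumes S: "dominated_linear_graph E M phi p S" and "subspace E" and p: "sublinear_on E p"
    and x0: "x0 \<in> E" and yv: "(y, v) \<in> S"
    and c_lower: "\<And>z v. (z, v) \<in> S \<Longrightarrow> v - p (z - x0) \<le> c"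
    and c_upper: "\<And>z v. (z, v) \<in> S \<Longrightarrow> c \<le> p (z + x0) - v"
  shows "v + t * c \<le> p (y + t *\<^sub>R x0)"
proof (cases t "0::real" rule: linorder_cases)
  case less
  define s where "s = - t"
  have s: "s > 0" using less by (simp add: s_def)
  have "(1 / s) * v - p ((1 / s) *\<^sub>R y - x0) \<le> c"
    using c_lower dominated_linear_graphD(6)[OF S yv] by blast
  then have "v - s * p ((1 / s) *\<^sub>R y - x0) \<le> s * c"
    using s by (simp add: field_simps)
  moreover have "s * p ((1 / s) *\<^sub>R y - x0) = p (y + t *\<^sub>R x0)"
  proof -
    have "(1 / s) *\<^sub>R y - x0 \<in> E"
      using dominated_linear_graphD(2)[OF S yv] x0 \<open>subspace E\<close>
      by (simp add: subspace_diff subspace_scale)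
    then have "s * p ((1 / s) *\<^sub>R y - x0) = p (s *\<^sub>R ((1 / s) *\<^sub>R y - x0))"
      using sublinear_onD(2)[OF p] s by simp
    also have "s *\<^sub>R ((1 / s) *\<^sub>R y - x0) = y + t *\<^sub>R x0"
      using s by (simp add: s_def scaleR_diff_right)
    finally show ?thesis .
  qed
  ultimately show ?thesis by (simp add: s_def)
next
  case equal
  then show ?thesis using dominated_linear_graphD(4)[OF S yv] by simp
next
  case greater
  have "c \<le> p ((1 / t) *\<^sub>R y + x0) - (1 / t) * v"
    using c_upper dominated_linear_graphD(6)[OF S yv] by blast
  then have "t * c \<le> t * p ((1 / t) *\<^sub>R y + x0) - v"
    using greater by (simp add: field_simps)
  moreover have "t * p ((1 / t) *\<^sub>R y + x0) = p (y + t *\<^sub>R x0)"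
    using sublinear_onD(2)[OF p, of "(1 / t) *\<^sub>R y + x0" t] greater
      dominated_linear_graphD(2)[OF S yv] x0 \<open>subspace E\<close>
    by (simp add: subspace_add subspace_scale scaleR_add_right)
  ultimately show ?thesis by simp
qed

lemma dominated_linear_graph_extend:
  assumes S: "dominated_linear_graph E M phi p S" and "subspace E" and p: "sublinear_on E p"
    and S00: "(0, 0) \<in> S" and x0: "x0 \<in> E" "\<And>v. (x0, v) \<notin> S"
  obtains S' where "dominated_linear_graph E M phi p S'" "S \<subset> S'"
proof -
  note Sfun = dominated_linear_graphD(1)[OF S] and SE = dominated_linear_graphD(2)[OF S]
    and SM = dominated_linear_graphD(3)[OF S] and Sadd = dominated_linear_graphD(5)[OF S]
    and Ssc = dominated_linear_graphD(6)[OF S]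
  obtain c where c: "\<And>z v. (z, v) \<in> S \<Longrightarrow> v - p (z - x0) \<le> c"
    "\<And>z v. (z, v) \<in> S \<Longrightarrow> c \<le> p (z + x0) - v"
    using dominated_linear_graph_value[OF S \<open>subspace E\<close> p S00 x0(1)] by blast
  define S' where "S' = {(y + t *\<^sub>R x0, v + t * c) | y v t. (y, v) \<in> S}"
  note dom' = dominated_linear_graph_value_le[OF S \<open>subspace E\<close> p x0(1) _ c]
  have fun': "w = w'" if xw: "(x, w) \<in> S'" "(x, w') \<in> S'" for x w w'
  proof -
    obtain y v t y' v' t' where yv: "(y, v) \<in> S" "x = y + t *\<^sub>R x0" "w = v + t * c"
      and yv': "(y', v') \<in> S" "x = y' + t' *\<^sub>R x0" "w' = v' + t' * c"
      using xw unfolding S'_def by blast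
    have "t = t'"
    proof (rule ccontr)
      assume "t \<noteq> t'"
      have "y' - y = (t - t') *\<^sub>R x0"
        using yv(2) yv'(2) by (simp add: scaleR_diff_left eq_diff_eq diff_eq_eq algebra_simps)
      then have "(1 / (t - t')) *\<^sub>R (y' + (-1) *\<^sub>R y) = x0"
        using \<open>t \<noteq> t'\<close> by simp
      moreover have "((1 / (t - t')) *\<^sub>R (y' + (-1) *\<^sub>R y), (1 / (t - t')) * (v' + (-1) * v)) \<in> S"
        using Ssc Sadd[OF yv'(1) Ssc[OF yv(1)]] by blast
      ultimately show False using x0(2) by metis
    qed
    then show ?thesis using yv yv' Sfun by auto
  qed
  have "dominated_linear_graph E M phi p S'"
    unfolding dominated_linear_graph_def
  proof (intro conjI allI impI)
    show "fst ` S' \<subseteq> E"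
      using SE x0(1) \<open>subspace E\<close> by (auto simp: S'_def subspace_add subspace_scale)
    show "\<forall>x \<in> M. (x, phi x) \<in> S'"
      unfolding S'_def using SM by force
    fix x v y u assume "(x, v) \<in> S'" "(y, u) \<in> S'"
    then obtain x1 v1 t1 y1 u1 t2 where "(x1, v1) \<in> S" "(y1, u1) \<in> S"
      and "(x, v) = (x1 + t1 *\<^sub>R x0, v1 + t1 * c)" "(y, u) = (y1 + t2 *\<^sub>R x0, u1 + t2 * c)"
      unfolding S'_def by blast
    moreover have "(x + y, v + u) = ((x1 + y1) + (t1 + t2) *\<^sub>R x0, (v1 + u1) + (t1 + t2) * c)"
      using calculation by (simp add: algebra_simps)
    ultimately show "(x + y, v + u) \<in> S'" unfolding S'_def using Sadd by blast
  next
    fix a x v assume "(x, v) \<in> S'"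
    then obtain x1 v1 t where "(x1, v1) \<in> S" "(x, v) = (x1 + t *\<^sub>R x0, v1 + t * c)"
      unfolding S'_def by blast
    moreover have "(a *\<^sub>R x, a * v) = (a *\<^sub>R x1 + (a * t) *\<^sub>R x0, a * v1 + (a * t) * c)"
      using calculation by (simp add: algebra_simps)
    ultimately show "(a *\<^sub>R x, a * v) \<in> S'" unfolding S'_def using Ssc by blast
  qed (use fun' dom' in \<open>auto simp: S'_def\<close>)
  moreover have "S \<subseteq> S'"
    unfolding S'_def by (force intro: exI[of _ 0])
  moreover have "(x0, c) \<in> S'"
    unfolding S'_def using S00 by (force intro: exI[of _ 1])
  ultimately show ?thesis using that x0(2) by blast
qed

theorem hahn_banach:
  assumes E: "subspace E" and M: "subspace M" "M \<subseteq> E" and phi: "linear_on M phi"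
    and p: "sublinear_on E p" and dom: "\<And>x. x \<in> M \<Longrightarrow> phi x \<le> p x"
  obtains Psi where "linear_on E Psi" "\<And>x. x \<in> M \<Longrightarrow> Psi x = phi x"
    "\<And>x. x \<in> E \<Longrightarrow> Psi x \<le> p x"
proof -
  define A where "A = {S. dominated_linear_graph E M phi p S}"
  have "dominated_linear_graph E M phi p {(x, phi x) | x. x \<in> M}"
    by (rule dominated_linear_graph_of_functional[OF M phi dom])
  then have graph_phi: "{(x, phi x) | x. x \<in> M} \<in> A" by (simp add: A_def)
  have "\<exists>S \<in> A. \<forall>X \<in> C. X \<subseteq> S" if C: "C \<in> chains A" for C
  proof (cases "C = {}")
    case True
    then show ?thesis using graph_phi by blast
  next
    case False
    from C have "C \<subseteq> A" "chain\<^sub>\<subseteq> C" by (auto simp: chains_def)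
    then have "dominated_linear_graph E M phi p (\<Union>C)"
      using False by (intro dominated_linear_graph_Union) (auto simp: A_def)
    then show ?thesis by (auto simp: A_def)
  qed
  then have "\<exists>S \<in> A. \<forall>S'\<in>A. S \<subseteq> S' \<longrightarrow> S' = S"
    by (intro Zorn_Lemma2 ballI)
  then obtain S where "S \<in> A" and S_max: "\<And>S'. S' \<in> A \<Longrightarrow> S \<subseteq> S' \<Longrightarrow> S' = S"
    by blast
  then have S: "dominated_linear_graph E M phi p S" by (simp add: A_def)
  note Sfun = dominated_linear_graphD(1)[OF S] and SE = dominated_linear_graphD(2)[OF S]
    and SM = dominated_linear_graphD(3)[OF S] and Sdom = dominated_linear_graphD(4)[OF S]
    and Sadd = dominated_linear_graphD(5)[OF S] and Ssc = dominated_linear_graphD(6)[OF S]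
  have S00: "(0, 0) \<in> S"
    using SM[OF subspace_0[OF M(1)]] linear_on_zero[OF phi M(1)] by simp
  have total: "\<exists>v. (x, v) \<in> S" if x: "x \<in> E" for x
  proof (rule ccontr)
    assume "\<nexists>v. (x, v) \<in> S"
    then obtain S' where "dominated_linear_graph E M phi p S'" "S \<subset> S'"
      using dominated_linear_graph_extend[OF S E p S00 x] by blast
    then show False using S_max[of S'] by (auto simp: A_def)
  qed
  define Psi where "Psi x = (THE v. (x, v) \<in> S)" for x
  have Psi: "(x, Psi x) \<in> S" if "x \<in> E" for x
    using total[OF that] Sfun unfolding Psi_def by (metis theI)
  have Psi_eq: "Psi x = v" if "(x, v) \<in> S" for x v
    using Sfun Psi SE that by blast
  have "linear_on E Psi"
    unfolding linear_on_def real_scaleR_def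
    using Psi_eq[OF Sadd[OF Psi Psi]] Psi_eq[OF Ssc[OF Psi]] by blast
  moreover have "Psi x = phi x" if "x \<in> M" for x
    using Psi_eq[OF SM[OF that]] .
  moreover have "Psi x \<le> p x" if "x \<in> E" for x
    using Sdom[OF Psi[OF that]] .
  ultimately show ?thesis using that by blast
qed

lemma subspace_linear_on_image:
  assumes L: "subspace L" and f: "linear_on L f"
  shows "subspace (f ` L)"
  unfolding subspace_def
proof (intro conjI ballI allI)
  show "0 \<in> f ` L"
    using linear_on_zero[OF f L] subspace_0[OF L] by (metis image_eqI)
next
  fix x y assume "x \<in> f ` L" "y \<in> f ` L"
  then obtain a b where "a \<in> L" "b \<in> L" "x = f a" "y = f b" by blast
  then show "x + y \<in> f ` L"
    using linear_onD(1)[OF f] subspace_add[OF L] by (metis image_eqI)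
next
  fix c x assume "x \<in> f ` L"
  then obtain a where "a \<in> L" "x = f a" by blast
  then show "c *\<^sub>R x \<in> f ` L"
    using linear_onD(2)[OF f] subspace_scale[OF L] by (metis image_eqI)
qed

text \<open>Domination forces \<open>phi\<close> to be constant on the fibres of \<open>ell\<close>, so it descends to the
  image of \<open>ell\<close>.\<close>

theorem hahn_banach_image:
  assumes E: "subspace E" and L: "subspace L" and ell: "linear_on L ell" "ell ` L \<subseteq> E"
    and phi: "linear_on L phi" and p: "sublinear_on E p"
    and dom: "\<And>a. a \<in> L \<Longrightarrow> phi a \<le> p (ell a)"
  obtains Psi where "linear_on E Psi" "\<And>a. a \<in> L \<Longrightarrow> Psi (ell a) = phi a"
    "\<And>x. x \<in> E \<Longrightarrow> Psi x \<le> p x"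
proof -
  have p0: "p 0 = 0"
    using sublinear_onD(2)[OF p subspace_0[OF E], of 0] by simp
  have fibre: "phi a = phi b" if ab: "a \<in> L" "b \<in> L" "ell a = ell b" for a b
  proof -
    have "ell (a - b) = 0" "ell (b - a) = 0"
      using ab linear_on_diff[OF ell(1) L] by simp_all
    then have "phi (a - b) \<le> 0" "phi (b - a) \<le> 0"
      using dom[of "a - b"] dom[of "b - a"] ab p0 subspace_diff[OF L] by simp_all
    then show ?thesis using ab linear_on_diff[OF phi L] by simp
  qed
  define phi' where "phi' v = phi (SOME a. a \<in> L \<and> ell a = v)" for v
  have phi'_ell: "phi' (ell a) = phi a" if a: "a \<in> L" for a
  proof -
    define b where "b = (SOME b. b \<in> L \<and> ell b = ell a)"
    have "b \<in> L \<and> ell b = ell a"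
      unfolding b_def using someI_ex[of "\<lambda>b. b \<in> L \<and> ell b = ell a"] a by blast
    then show ?thesis using fibre[OF _ a] by (simp add: phi'_def flip: b_def)
  qed
  have "linear_on (ell ` L) phi'"
    unfolding linear_on_def
  proof (intro conjI ballI allI)
    fix x y assume "x \<in> ell ` L" "y \<in> ell ` L"
    then obtain a b where ab: "a \<in> L" "b \<in> L" "x = ell a" "y = ell b" by blast
    then have "x + y = ell (a + b)" using linear_onD(1)[OF ell(1)] by simp
    then show "phi' (x + y) = phi' x + phi' y"
      using ab by (simp add: phi'_ell subspace_add[OF L] linear_onD(1)[OF phi])
  next
    fix c x assume "x \<in> ell ` L"
    then obtain a where a: "a \<in> L" "x = ell a" by blast
    then have "c *\<^sub>R x = ell (c *\<^sub>R a)" using linear_onD(2)[OF ell(1)] by simp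
    then show "phi' (c *\<^sub>R x) = c *\<^sub>R phi' x"
      using a by (simp add: phi'_ell subspace_scale[OF L] linear_onD(2)[OF phi])
  qed
  moreover have "phi' x \<le> p x" if "x \<in> ell ` L" for x
    using that dom phi'_ell by auto
  ultimately obtain Psi where "linear_on E Psi" "\<And>x. x \<in> ell ` L \<Longrightarrow> Psi x = phi' x"
    "\<And>x. x \<in> E \<Longrightarrow> Psi x \<le> p x"
    using hahn_banach[OF E subspace_linear_on_image[OF L ell(1)] ell(2) _ p] by blast
  then show ?thesis using that phi'_ell by simp
qed

section \<open>Duals and biduals\<close>

text \<open>Pointwise operations on functions, so that Hahn--Banach applies to spaces of functionals.\<close>

instantiation "fun" :: (type, real_vector) real_vector
begin

definition scaleR_fun :: "real \<Rightarrow> ('a \<Rightarrow> 'b) \<Rightarrow> 'a \<Rightarrow> 'b" where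
  "scaleR_fun c f = (\<lambda>x. c *\<^sub>R f x)"

instance by standard (auto simp: scaleR_fun_def fun_eq_iff scaleR_add_right scaleR_add_left)

end

lemma linear_on_evaluation: "linear_on A (\<lambda>f. f x)"
  by (simp add: linear_on_def plus_fun_def scaleR_fun_def)

locale homogeneous_space =
  fixes V :: "'v set" and ad :: "'v \<Rightarrow> 'v \<Rightarrow> 'v" and sc :: "real \<Rightarrow> 'v \<Rightarrow> 'v"
    and p :: "'v \<Rightarrow> real"
  assumes carrier_nonempty: "V \<noteq> {}"
    and add_closed: "\<And>x y. x \<in> V \<Longrightarrow> y \<in> V \<Longrightarrow> ad x y \<in> V"
    and scale_closed: "\<And>c x. x \<in> V \<Longrightarrow> sc c x \<in> V"
    and p_nonneg: "\<And>x. x \<in> V \<Longrightarrow> 0 \<le> p x"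
    and p_scale: "\<And>c x. x \<in> V \<Longrightarrow> p (sc c x) = \<bar>c\<bar> * p x"
begin

abbreviation "dual \<equiv> sdual V ad sc p"
abbreviation "dual_norm \<equiv> sdnorm V p"
abbreviation "bidual \<equiv> sbidual V ad sc p"
abbreviation "bidual_norm \<equiv> sbdnorm V ad sc p"
abbreviation "canon \<equiv> scanon V ad sc p"

lemma dual_add: "f \<in> dual \<Longrightarrow> x \<in> V \<Longrightarrow> y \<in> V \<Longrightarrow> f (ad x y) = f x + f y"
  and dual_scale: "f \<in> dual \<Longrightarrow> x \<in> V \<Longrightarrow> f (sc c x) = c * f x"
  and dual_outside: "f \<in> dual \<Longrightarrow> x \<notin> V \<Longrightarrow> f x = 0"
  and dual_bounded: "f \<in> dual \<Longrightarrow> \<exists>C. \<forall>x \<in> V. \<bar>f x\<bar> \<le> C * p x"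
  unfolding sdual_def by auto

lemma dualI:
  assumes "\<And>x y. x \<in> V \<Longrightarrow> y \<in> V \<Longrightarrow> f (ad x y) = f x + f y"
    and "\<And>c x. x \<in> V \<Longrightarrow> f (sc c x) = c * f x"
    and "\<And>x. x \<notin> V \<Longrightarrow> f x = 0" and "\<And>x. x \<in> V \<Longrightarrow> \<bar>f x\<bar> \<le> C * p x"
  shows "f \<in> dual"
  unfolding sdual_def using assms by blast

lemma unit_ball_nonempty: "{x \<in> V. p x \<le> 1} \<noteq> {}"
proof -
  obtain x0 where "x0 \<in> V" using carrier_nonempty by blast
  then have "sc 0 x0 \<in> V" "p (sc 0 x0) = 0" using scale_closed p_scale by auto
  then show ?thesis by force
qed

lemma bdd_above_dual_unit_ball:
  assumes "f \<in> dual"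
  shows "bdd_above ((\<lambda>x. \<bar>f x\<bar>) ` {x \<in> V. p x \<le> 1})"
proof -
  obtain C where C: "\<forall>x \<in> V. \<bar>f x\<bar> \<le> C * p x" using dual_bounded[OF assms] by blast
  have "\<bar>f x\<bar> \<le> max C 0" if "x \<in> V" "p x \<le> 1" for x
  proof -
    have "\<bar>f x\<bar> \<le> C * p x" using C that by blast
    also have "\<dots> \<le> max C 0 * p x" using p_nonneg[OF that(1)] by (intro mult_right_mono) auto
    also have "\<dots> \<le> max C 0" using p_nonneg[OF that(1)] that(2) by (simp add: mult_left_le)
    finally show ?thesis .
  qed
  then show ?thesis unfolding bdd_above_def by blast
qed

lemma dual_norm_upper: "f \<in> dual \<Longrightarrow> x \<in> V \<Longrightarrow> p x \<le> 1 \<Longrightarrow> \<bar>f x\<bar> \<le> dual_norm f"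
  unfolding sdnorm_def by (rule cSUP_upper[OF _ bdd_above_dual_unit_ball]) auto

lemma dual_norm_nonneg:
  assumes f: "f \<in> dual"
  shows "0 \<le> dual_norm f"
proof -
  obtain x where "x \<in> V" "p x \<le> 1" using unit_ball_nonempty by blast
  then have "\<bar>f x\<bar> \<le> dual_norm f" using dual_norm_upper[OF f] by blast
  then show ?thesis by linarith
qed

lemma dual_norm_least: "(\<And>x. x \<in> V \<Longrightarrow> p x \<le> 1 \<Longrightarrow> \<bar>f x\<bar> \<le> C) \<Longrightarrow> dual_norm f \<le> C"
  unfolding sdnorm_def by (rule cSUP_least[OF unit_ball_nonempty]) auto

lemma dual_norm_bound:
  assumes f: "f \<in> dual" and x: "x \<in> V"
  shows "\<bar>f x\<bar> \<le> dual_norm f * p x"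
proof (cases "p x = 0")
  case True
  obtain C where C: "\<forall>x \<in> V. \<bar>f x\<bar> \<le> C * p x" using dual_bounded[OF f] by blast
  then show ?thesis using True x by force
next
  case False
  then have px: "p x > 0" using p_nonneg[OF x] by simp
  let ?z = "sc (1 / p x) x"
  have zV: "?z \<in> V" using scale_closed x by blast
  have pz: "p ?z = 1" using p_scale[OF x] px by simp
  have "\<bar>f ?z\<bar> = \<bar>f x\<bar> / p x" using dual_scale[OF f x] px by (simp add: abs_mult)
  then have "\<bar>f x\<bar> / p x \<le> dual_norm f" using dual_norm_upper[OF f zV] pz by simp
  then show ?thesis using px by (simp add: divide_le_eq)
qed

lemma dual_closed_zero: "(\<lambda>x. 0) \<in> dual"
  by (rule dualI[where C=0]) auto

lemma dual_closed_add:
  assumes "f \<in> dual" "g \<in> dual"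
  shows "(\<lambda>x. f x + g x) \<in> dual"
proof (rule dualI[where C="dual_norm f + dual_norm g"])
  fix x assume x: "x \<in> V"
  have "\<bar>f x + g x\<bar> \<le> \<bar>f x\<bar> + \<bar>g x\<bar>" by (rule abs_triangle_ineq)
  also have "\<dots> \<le> dual_norm f * p x + dual_norm g * p x"
    using dual_norm_bound assms x by (intro add_mono) auto
  finally show "\<bar>f x + g x\<bar> \<le> (dual_norm f + dual_norm g) * p x" by (simp add: algebra_simps)
next
  fix x y assume "x \<in> V" "y \<in> V"
  then show "f (ad x y) + g (ad x y) = f x + g x + (f y + g y)"
    using dual_add[OF assms(1)] dual_add[OF assms(2)] by simp
next
  fix c x assume "x \<in> V"
  then show "f (sc c x) + g (sc c x) = c * (f x + g x)"
    using dual_scale[OF assms(1)] dual_scale[OF assms(2)] by (simp add: distrib_left)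
next
  fix x assume "x \<notin> V"
  then show "f x + g x = 0"
    using dual_outside[OF assms(1)] dual_outside[OF assms(2)] by simp
qed

lemma dual_closed_scale:
  assumes "f \<in> dual"
  shows "(\<lambda>x. c * f x) \<in> dual"
proof (rule dualI[where C="\<bar>c\<bar> * dual_norm f"])
  fix x assume x: "x \<in> V"
  have "\<bar>c * f x\<bar> = \<bar>c\<bar> * \<bar>f x\<bar>" by (simp add: abs_mult)
  also have "\<dots> \<le> \<bar>c\<bar> * (dual_norm f * p x)"
    using dual_norm_bound assms x by (intro mult_left_mono) auto
  finally show "\<bar>c * f x\<bar> \<le> \<bar>c\<bar> * dual_norm f * p x" by (simp add: algebra_simps)
next
  fix x y assume "x \<in> V" "y \<in> V"
  then show "c * f (ad x y) = c * f x + c * f y"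
    using dual_add[OF assms(1)] by (simp add: distrib_left)
next
  fix d x assume "x \<in> V"
  then show "c * f (sc d x) = d * (c * f x)"
    using dual_scale[OF assms(1)] by simp
next
  fix x assume "x \<notin> V"
  then show "c * f x = 0" using dual_outside[OF assms(1)] by simp
qed

lemma dual_norm_add_le:
  assumes "f \<in> dual" "g \<in> dual"
  shows "dual_norm (\<lambda>x. f x + g x) \<le> dual_norm f + dual_norm g"
proof (rule dual_norm_least)
  fix x assume x: "x \<in> V" "p x \<le> 1"
  have "\<bar>f x + g x\<bar> \<le> \<bar>f x\<bar> + \<bar>g x\<bar>" by (rule abs_triangle_ineq)
  also have "\<dots> \<le> dual_norm f + dual_norm g" using dual_norm_upper assms x by (intro add_mono) auto
  finally show "\<bar>f x + g x\<bar> \<le> dual_norm f + dual_norm g" .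
qed

lemma dual_norm_scale_le:
  assumes "f \<in> dual"
  shows "dual_norm (\<lambda>x. c * f x) \<le> \<bar>c\<bar> * dual_norm f"
proof (rule dual_norm_least)
  fix x assume x: "x \<in> V" "p x \<le> 1"
  have "\<bar>c * f x\<bar> = \<bar>c\<bar> * \<bar>f x\<bar>" by (simp add: abs_mult)
  also have "\<dots> \<le> \<bar>c\<bar> * dual_norm f" using dual_norm_upper assms x by (intro mult_left_mono) auto
  finally show "\<bar>c * f x\<bar> \<le> \<bar>c\<bar> * dual_norm f" .
qed

lemma dual_norm_scale:
  assumes f: "f \<in> dual"
  shows "dual_norm (\<lambda>x. c * f x) = \<bar>c\<bar> * dual_norm f"
proof (cases "c = 0")
  case True
  then show ?thesis
    using dual_norm_scale_le[OF f, of c] dual_norm_nonneg[OF dual_closed_scale[OF f, of c]] by simp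
next
  case False
  have "dual_norm f = dual_norm (\<lambda>x. (1/c) * (c * f x))" using False by simp
  also have "\<dots> \<le> \<bar>1/c\<bar> * dual_norm (\<lambda>x. c * f x)"
    by (rule dual_norm_scale_le[OF dual_closed_scale[OF f]])
  finally have "\<bar>c\<bar> * dual_norm f \<le> dual_norm (\<lambda>x. c * f x)" using False
    by (simp add: field_simps abs_div_pos)
  then show ?thesis using dual_norm_scale_le[OF f, of c] by simp
qed

lemma dual_norm_eq_0D:
  assumes f: "f \<in> dual" and z: "dual_norm f = 0"
  shows "f = (\<lambda>x. 0)"
proof
  fix x show "f x = 0"
  proof (cases "x \<in> V")
    case True then show ?thesis using dual_norm_bound[OF f True] z by simp
  qed (use dual_outside f in auto)
qed

lemma bidual_add: "\<Phi> \<in> bidual \<Longrightarrow> f \<in> dual \<Longrightarrow> g \<in> dual \<Longrightarrow> \<Phi> (\<lambda>x. f x + g x) = \<Phi> f + \<Phi> g"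
  and bidual_scale: "\<Phi> \<in> bidual \<Longrightarrow> f \<in> dual \<Longrightarrow> \<Phi> (\<lambda>x. c * f x) = c * \<Phi> f"
  and bidual_outside: "\<Phi> \<in> bidual \<Longrightarrow> f \<notin> dual \<Longrightarrow> \<Phi> f = 0"
  and bidual_bounded: "\<Phi> \<in> bidual \<Longrightarrow> \<exists>C. \<forall>f \<in> dual. \<bar>\<Phi> f\<bar> \<le> C * dual_norm f"
  unfolding sbidual_def by auto

lemma bidualI:
  assumes "\<And>f g. f \<in> dual \<Longrightarrow> g \<in> dual \<Longrightarrow> \<Phi> (\<lambda>x. f x + g x) = \<Phi> f + \<Phi> g"
    and "\<And>c f. f \<in> dual \<Longrightarrow> \<Phi> (\<lambda>x. c * f x) = c * \<Phi> f"
    and "\<And>f. f \<notin> dual \<Longrightarrow> \<Phi> f = 0" and "\<And>f. f \<in> dual \<Longrightarrow> \<bar>\<Phi> f\<bar> \<le> C * dual_norm f"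
  shows "\<Phi> \<in> bidual"
  unfolding sbidual_def using assms by blast

lemma bidual_zero: "\<Phi> \<in> bidual \<Longrightarrow> \<Phi> (\<lambda>x. 0) = 0"
  using bidual_scale[of \<Phi> "\<lambda>x. 0" 0] dual_closed_zero by simp

lemma dual_norm_zero: "dual_norm (\<lambda>x. 0) = 0"
  using dual_norm_least[of "\<lambda>x. 0" 0] dual_norm_nonneg[OF dual_closed_zero] by simp

lemma dual_unit_ball_nonempty: "{f \<in> dual. dual_norm f \<le> 1} \<noteq> {}"
  using dual_closed_zero dual_norm_zero by force

lemma bdd_above_bidual_unit_ball:
  assumes "\<Phi> \<in> bidual"
  shows "bdd_above ((\<lambda>f. \<bar>\<Phi> f\<bar>) ` {f \<in> dual. dual_norm f \<le> 1})"
proof -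
  obtain C where C: "\<forall>f \<in> dual. \<bar>\<Phi> f\<bar> \<le> C * dual_norm f" using bidual_bounded[OF assms] by blast
  have "\<bar>\<Phi> f\<bar> \<le> max C 0" if "f \<in> dual" "dual_norm f \<le> 1" for f
  proof -
    have "\<bar>\<Phi> f\<bar> \<le> C * dual_norm f" using C that by blast
    also have "\<dots> \<le> max C 0 * dual_norm f"
      using dual_norm_nonneg[OF that(1)] by (intro mult_right_mono) auto
    also have "\<dots> \<le> max C 0" using dual_norm_nonneg[OF that(1)] that(2) by (simp add: mult_left_le)
    finally show ?thesis .
  qed
  then show ?thesis unfolding bdd_above_def by blast
qed

lemma bidual_norm_upper: "\<Phi> \<in> bidual \<Longrightarrow> f \<in> dual \<Longrightarrow> dual_norm f \<le> 1 \<Longrightarrow> \<bar>\<Phi> f\<bar> \<le> bidual_norm \<Phi>"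
  unfolding sbdnorm_def by (rule cSUP_upper[OF _ bdd_above_bidual_unit_ball]) auto

lemma bidual_norm_nonneg:
  assumes P: "\<Phi> \<in> bidual"
  shows "0 \<le> bidual_norm \<Phi>"
proof -
  have "\<bar>\<Phi> (\<lambda>x. 0)\<bar> \<le> bidual_norm \<Phi>"
    using bidual_norm_upper[OF P dual_closed_zero] dual_norm_zero by simp
  then show ?thesis by linarith
qed

lemma bidual_norm_approx:
  assumes "\<Phi> \<in> bidual" "r < bidual_norm \<Phi>"
  shows "\<exists>f \<in> dual. dual_norm f \<le> 1 \<and> r < \<bar>\<Phi> f\<bar>"
  using assms(2) less_cSUP_iff[OF dual_unit_ball_nonempty bdd_above_bidual_unit_ball[OF assms(1)]]
  unfolding sbdnorm_def by auto

lemma bidual_norm_bound: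
  assumes P: "\<Phi> \<in> bidual" and f: "f \<in> dual"
  shows "\<bar>\<Phi> f\<bar> \<le> bidual_norm \<Phi> * dual_norm f"
proof (cases "dual_norm f = 0")
  case True
  then have "f = (\<lambda>x. 0)" using dual_norm_eq_0D f by blast
  then show ?thesis using bidual_zero[OF P] True by simp
next
  case False
  then have d: "dual_norm f > 0" using dual_norm_nonneg[OF f] by simp
  let ?g = "\<lambda>x. (1 / dual_norm f) * f x"
  have gD: "?g \<in> dual" using dual_closed_scale[OF f] .
  have dg: "dual_norm ?g \<le> 1" using dual_norm_scale[OF f, of "1 / dual_norm f"] d by simp
  have "\<Phi> ?g = (1 / dual_norm f) * \<Phi> f" by (rule bidual_scale[OF P f])
  then have "\<bar>\<Phi> ?g\<bar> = \<bar>\<Phi> f\<bar> / dual_norm f" using d by (simp add: abs_mult)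
  then have "\<bar>\<Phi> f\<bar> / dual_norm f \<le> bidual_norm \<Phi>" using bidual_norm_upper[OF P gD dg] by simp
  then show ?thesis using d by (simp add: divide_le_eq)
qed

lemma bidual_closed_diff:
  assumes P: "\<Phi> \<in> bidual" and Q: "\<Psi> \<in> bidual"
  shows "(\<lambda>f. \<Phi> f - \<Psi> f) \<in> bidual"
proof (rule bidualI[where C="bidual_norm \<Phi> + bidual_norm \<Psi>"])
  fix f assume f: "f \<in> dual"
  have "\<bar>\<Phi> f - \<Psi> f\<bar> \<le> \<bar>\<Phi> f\<bar> + \<bar>\<Psi> f\<bar>" by (rule abs_triangle_ineq4)
  also have "\<dots> \<le> bidual_norm \<Phi> * dual_norm f + bidual_norm \<Psi> * dual_norm f"
    using bidual_norm_bound P Q f by (intro add_mono) auto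
  finally show "\<bar>\<Phi> f - \<Psi> f\<bar> \<le> (bidual_norm \<Phi> + bidual_norm \<Psi>) * dual_norm f"
    by (simp add: algebra_simps)
next
  fix f g assume "f \<in> dual" "g \<in> dual"
  then show "\<Phi> (\<lambda>x. f x + g x) - \<Psi> (\<lambda>x. f x + g x) = \<Phi> f - \<Psi> f + (\<Phi> g - \<Psi> g)"
    using bidual_add[OF P] bidual_add[OF Q] by simp
next
  fix c f assume "f \<in> dual"
  then show "\<Phi> (\<lambda>x. c * f x) - \<Psi> (\<lambda>x. c * f x) = c * (\<Phi> f - \<Psi> f)"
    using bidual_scale[OF P] bidual_scale[OF Q] by (simp add: right_diff_distrib)
next
  fix f assume "f \<notin> dual"
  then show "\<Phi> f - \<Psi> f = 0"
    using bidual_outside[OF P] bidual_outside[OF Q] by simp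
qed

lemma bidual_closed_scale:
  assumes P: "\<Phi> \<in> bidual"
  shows "(\<lambda>f. c * \<Phi> f) \<in> bidual"
proof (rule bidualI[where C="\<bar>c\<bar> * bidual_norm \<Phi>"])
  fix f assume f: "f \<in> dual"
  have "\<bar>c * \<Phi> f\<bar> = \<bar>c\<bar> * \<bar>\<Phi> f\<bar>" by (simp add: abs_mult)
  also have "\<dots> \<le> \<bar>c\<bar> * (bidual_norm \<Phi> * dual_norm f)"
    using bidual_norm_bound P f by (intro mult_left_mono) auto
  finally show "\<bar>c * \<Phi> f\<bar> \<le> \<bar>c\<bar> * bidual_norm \<Phi> * dual_norm f" by (simp add: algebra_simps)
next
  fix f g assume "f \<in> dual" "g \<in> dual"
  then show "c * \<Phi> (\<lambda>x. f x + g x) = c * \<Phi> f + c * \<Phi> g"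
    using bidual_add[OF P] by (simp add: distrib_left)
next
  fix d f assume "f \<in> dual"
  then show "c * \<Phi> (\<lambda>x. d * f x) = d * (c * \<Phi> f)"
    using bidual_scale[OF P] by simp
next
  fix f assume "f \<notin> dual"
  then show "c * \<Phi> f = 0" using bidual_outside[OF P] by simp
qed

lemma subspace_dual: "subspace dual"
  unfolding subspace_def zero_fun_def plus_fun_def scaleR_fun_def
  using dual_closed_zero dual_closed_add dual_closed_scale by simp

lemma sublinear_on_dual_norm: "sublinear_on dual dual_norm"
  unfolding sublinear_on_def plus_fun_def scaleR_fun_def
  using dual_norm_add_le dual_norm_scale by simp

lemma bidual_of_dominated:
  assumes \<Psi>: "linear_on dual \<Psi>" and le: "\<And>f. f \<in> dual \<Longrightarrow> \<Psi> f \<le> C * dual_norm f"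
  shows "(\<lambda>f. if f \<in> dual then \<Psi> f else 0) \<in> bidual"
proof (rule bidualI[where C = C])
  fix f g assume "f \<in> dual" "g \<in> dual"
  then show "(if (\<lambda>x. f x + g x) \<in> dual then \<Psi> (\<lambda>x. f x + g x) else 0)
      = (if f \<in> dual then \<Psi> f else 0) + (if g \<in> dual then \<Psi> g else 0)"
    using linear_onD(1)[OF \<Psi>] dual_closed_add by (simp add: plus_fun_def)
next
  fix c f assume "f \<in> dual"
  then show "(if (\<lambda>x. c * f x) \<in> dual then \<Psi> (\<lambda>x. c * f x) else 0)
      = c * (if f \<in> dual then \<Psi> f else 0)"
    using linear_on_real_scale[OF \<Psi>] dual_closed_scale by (simp add: scaleR_fun_def)
next
  fix f assume f: "f \<in> dual"
  have "\<Psi> (\<lambda>x. (-1) * f x) = - \<Psi> f"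
    using linear_on_real_scale[OF \<Psi> f, of "-1"] by (simp add: scaleR_fun_def)
  then have "- \<Psi> f \<le> C * dual_norm f"
    using le[OF dual_closed_scale[OF f, of "-1"]] dual_norm_scale[OF f, of "-1"] by simp
  then show "\<bar>if f \<in> dual then \<Psi> f else 0\<bar> \<le> C * dual_norm f" using le[OF f] f by simp
qed simp

lemma canon_apply: "f \<in> dual \<Longrightarrow> canon x f = f x"
  unfolding scanon_def by simp

lemma canon_in_bidual:
  assumes x: "x \<in> V"
  shows "canon x \<in> bidual"
proof (rule bidualI[where C="p x"])
  fix f assume f: "f \<in> dual"
  have "\<bar>f x\<bar> \<le> dual_norm f * p x" using dual_norm_bound[OF f x] .
  then show "\<bar>canon x f\<bar> \<le> p x * dual_norm f" using canon_apply[OF f] by (simp only: mult.commute)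
next
  fix f g assume f: "f \<in> dual" and g: "g \<in> dual"
  show "canon x (\<lambda>y. f y + g y) = canon x f + canon x g"
    using canon_apply[OF dual_closed_add[OF f g]] canon_apply[OF f] canon_apply[OF g] by simp
next
  fix c f assume f: "f \<in> dual"
  show "canon x (\<lambda>y. c * f y) = c * canon x f"
    using canon_apply[OF dual_closed_scale[OF f]] canon_apply[OF f] by simp
next
  fix f assume "f \<notin> dual"
  then show "canon x f = 0" by (simp add: scanon_def)
qed

end

locale bounded_operator = X: homogeneous_space V ad sc p + Y: homogeneous_space W ad' sc' q
  for V :: "'v set" and ad sc p and W :: "'w set" and ad' sc' q +
  fixes T :: "'v \<Rightarrow> 'w" and K :: real
  assumes T_closed: "\<And>x. x \<in> V \<Longrightarrow> T x \<in> W"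
    and T_add: "\<And>x y. x \<in> V \<Longrightarrow> y \<in> V \<Longrightarrow> T (ad x y) = ad' (T x) (T y)"
    and T_scale: "\<And>c x. x \<in> V \<Longrightarrow> T (sc c x) = sc' c (T x)"
    and T_bounded: "\<And>x. x \<in> V \<Longrightarrow> q (T x) \<le> K * p x" and K_nonneg: "0 \<le> K"
begin

text \<open>The adjoint \<open>T\<^sup>* g\<close>, extended by zero off the carrier like all elements of the dual.\<close>

abbreviation "adj g \<equiv> (\<lambda>x. if x \<in> V then g (T x) else 0)"
abbreviation "biadj \<equiv> sbiadj V ad sc p W ad' sc' q T"

lemma adj_bound:
  assumes g: "g \<in> Y.dual" and x: "x \<in> V"
  shows "\<bar>adj g x\<bar> \<le> (Y.dual_norm g * K) * p x"
proof -
  have "\<bar>g (T x)\<bar> \<le> Y.dual_norm g * q (T x)" using Y.dual_norm_bound[OF g T_closed[OF x]] .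
  also have "\<dots> \<le> Y.dual_norm g * (K * p x)"
    using T_bounded[OF x] Y.dual_norm_nonneg[OF g] by (intro mult_left_mono)
  finally show ?thesis using x by (simp add: mult.assoc)
qed

lemma adj_in_dual:
  assumes g: "g \<in> Y.dual"
  shows "adj g \<in> X.dual"
proof (rule X.dualI[where C="Y.dual_norm g * K"])
  fix x y assume "x \<in> V" "y \<in> V"
  then show "adj g (ad x y) = adj g x + adj g y"
    using X.add_closed T_add Y.dual_add[OF g] T_closed by simp
next
  fix c x assume "x \<in> V"
  then show "adj g (sc c x) = c * adj g x"
    using X.scale_closed T_scale Y.dual_scale[OF g] T_closed by simp
qed (use adj_bound g in auto)

lemma dual_norm_adj_le:
  assumes g: "g \<in> Y.dual"
  shows "X.dual_norm (adj g) \<le> Y.dual_norm g * K"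
proof (rule X.dual_norm_least)
  fix x assume x: "x \<in> V" "p x \<le> 1"
  have "\<bar>adj g x\<bar> \<le> (Y.dual_norm g * K) * p x" using adj_bound[OF g x(1)] .
  also have "\<dots> \<le> Y.dual_norm g * K" using x Y.dual_norm_nonneg[OF g] K_nonneg X.p_nonneg[OF x(1)]
    by (simp add: mult_left_le)
  finally show "\<bar>adj g x\<bar> \<le> Y.dual_norm g * K" .
qed

lemma biadj_apply: "g \<in> Y.dual \<Longrightarrow> biadj \<Phi> g = \<Phi> (adj g)"
  unfolding sbiadj_def by simp

lemma biadj_outside: "g \<notin> Y.dual \<Longrightarrow> biadj \<Phi> g = 0"
  unfolding sbiadj_def by simp

lemma adj_add: "adj (\<lambda>y. f y + g y) = (\<lambda>x. adj f x + adj (g :: 'w \<Rightarrow> real) x)"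
  by (rule ext) simp

lemma adj_scale: "adj (\<lambda>y. c * f y) = (\<lambda>x. c * adj (f :: 'w \<Rightarrow> real) x)"
  by (rule ext) simp

lemma linear_on_adj: "linear_on Y.dual adj"
  by (auto simp: linear_on_def plus_fun_def scaleR_fun_def fun_eq_iff)

lemma biadj_in_bidual:
  assumes P: "\<Phi> \<in> X.bidual"
  shows "biadj \<Phi> \<in> Y.bidual"
proof (rule Y.bidualI[where C="X.bidual_norm \<Phi> * K"])
  fix f g assume f: "f \<in> Y.dual" and g: "g \<in> Y.dual"
  show "biadj \<Phi> (\<lambda>x. f x + g x) = biadj \<Phi> f + biadj \<Phi> g"
    using biadj_apply Y.dual_closed_add[OF f g] f g adj_add
      X.bidual_add[OF P adj_in_dual[OF f] adj_in_dual[OF g]]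
    by simp
next
  fix c f assume f: "f \<in> Y.dual"
  show "biadj \<Phi> (\<lambda>x. c * f x) = c * biadj \<Phi> f"
    using biadj_apply Y.dual_closed_scale[OF f] f adj_scale X.bidual_scale[OF P adj_in_dual[OF f]]
    by simp
next
  fix f assume "f \<notin> Y.dual"
  then show "biadj \<Phi> f = 0" by (rule biadj_outside)
next
  fix f assume f: "f \<in> Y.dual"
  have "\<bar>biadj \<Phi> f\<bar> = \<bar>\<Phi> (adj f)\<bar>" using biadj_apply[OF f] by simp
  also have "\<dots> \<le> X.bidual_norm \<Phi> * X.dual_norm (adj f)"
    by (rule X.bidual_norm_bound[OF P adj_in_dual[OF f]])
  also have "\<dots> \<le> X.bidual_norm \<Phi> * (Y.dual_norm f * K)"
    using dual_norm_adj_le[OF f] X.bidual_norm_nonneg[OF P] by (rule mult_left_mono)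
  finally show "\<bar>biadj \<Phi> f\<bar> \<le> X.bidual_norm \<Phi> * K * Y.dual_norm f" by (simp add: algebra_simps)
qed

end

lemma bounded_operator_normed:
  fixes T :: "'a::real_normed_vector \<Rightarrow> 'b::real_normed_vector"
  assumes "bounded_linear T"
  shows "bounded_operator (UNIV :: 'a set) (+) (*\<^sub>R) norm (UNIV :: 'b set) (+) (*\<^sub>R) norm
    T (onorm T)"
  by unfold_locales
    (auto simp: onorm[OF assms] onorm_pos_le[OF assms] linear_simps[OF assms])

interpretation normed: homogeneous_space "UNIV :: 'a::real_normed_vector set" "(+)" "(*\<^sub>R)" norm
  by unfold_locales auto

lemma normed_dualD:
  assumes "f \<in> normed.dual"
  shows "f (x + y) = f x + f y" and "f (c *\<^sub>R x) = c * f x" and "f 0 = 0"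
    and "f (- x) = - f x" and "f (x - y) = f x - f y"
proof -
  show add: "f (x + y) = f x + f y" for x y using normed.dual_add[OF assms] by simp
  show scale: "f (c *\<^sub>R x) = c * f x" for c x using normed.dual_scale[OF assms] by simp
  show "f 0 = 0" using scale[of 0 0] by simp
  show minus: "f (- x) = - f x" for x using scale[of "-1" x] by simp
  show "f (x - y) = f x - f y" using add[of x "- y"] minus[of y] by simp
qed

section \<open>Limits along a free ultrafilter\<close>

lemma free_ultrafilter_nat_not_bot: "free_ultrafilter_nat U \<Longrightarrow> U \<noteq> bot"
  unfolding free_ultrafilter_nat_def by blast

lemma free_ultrafilter_nat_le_sequentially:
  assumes U: "free_ultrafilter_nat U"
  shows "U \<le> sequentially"
proof (rule filter_leI)
  fix P assume "eventually P sequentially"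
  then obtain N where N: "\<And>n. n \<ge> N \<Longrightarrow> P n" by (auto simp: eventually_sequentially)
  have "eventually (\<lambda>j. j \<noteq> n) U" for n
  proof -
    have "eventually (\<lambda>j. j \<in> {n}) U \<or> eventually (\<lambda>j. j \<notin> {n}) U"
      and "\<not> eventually (\<lambda>j. j = n) U"
      using U unfolding free_ultrafilter_nat_def by blast+
    then show ?thesis by simp
  qed
  then have "eventually (\<lambda>j. \<forall>n\<in>{..<N}. j \<noteq> n) U" by (intro eventually_ball_finite) auto
  then show "eventually P U" by (rule eventually_mono) (use N in \<open>auto simp: not_less[symmetric]\<close>)
qed

text \<open>The limit is the supremum of the eventual lower bounds.\<close>

lemma free_ultrafilter_nat_convergent:
  fixes s :: "nat \<Rightarrow> real"
  assumes U: "free_ultrafilter_nat U" and M: "\<And>j. \<bar>s j\<bar> \<le> M"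
  shows "\<exists>L. (s \<longlongrightarrow> L) U"
proof -
  define A where "A = {r. eventually (\<lambda>j. r \<le> s j) U}"
  have "-M \<le> s j" for j using M[of j] by linarith
  then have "-M \<in> A" unfolding A_def by (auto intro!: always_eventually)
  have "r \<le> M" if "r \<in> A" for r
  proof -
    have "eventually (\<lambda>j. r \<le> s j) U" using that by (simp add: A_def)
    then obtain j where "r \<le> s j"
      using eventually_happens'[OF free_ultrafilter_nat_not_bot[OF U]] by blast
    then show ?thesis using M[of j] by (simp add: abs_le_iff)
  qed
  then have bdd: "bdd_above A" by (rule bdd_aboveI)
  have "(s \<longlongrightarrow> Sup A) U"
  proof (rule order_tendstoI)
    fix a assume "a < Sup A"
    then obtain r where "r \<in> A" "a < r" using less_cSup_iff[OF _ bdd] \<open>-M \<in> A\<close> by blast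
    then show "eventually (\<lambda>j. a < s j) U" unfolding A_def by (auto elim: eventually_mono)
  next
    fix b assume "Sup A < b"
    then have "b \<notin> A" using cSup_upper[OF _ bdd] by force
    then have "\<not> eventually (\<lambda>j. j \<notin> {j. s j < b}) U" unfolding A_def by (auto simp: not_less)
    moreover have "eventually (\<lambda>j. j \<in> {j. s j < b}) U \<or> eventually (\<lambda>j. j \<notin> {j. s j < b}) U"
      using U unfolding free_ultrafilter_nat_def by blast
    ultimately show "eventually (\<lambda>j. s j < b) U" by simp
  qed
  then show ?thesis by blast
qed

lemma tendsto_Lim_free_ultrafilter_nat:
  fixes s :: "nat \<Rightarrow> real"
  assumes U: "free_ultrafilter_nat U" and M: "\<And>j. \<bar>s j\<bar> \<le> M"
  shows "(s \<longlongrightarrow> Lim U s) U"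
proof -
  obtain L where "(s \<longlongrightarrow> L) U" using free_ultrafilter_nat_convergent[OF U, of s M] M by blast
  then show ?thesis using tendsto_Lim free_ultrafilter_nat_not_bot[OF U] by metis
qed

lemma Lim_free_ultrafilter_nat:
  "free_ultrafilter_nat U \<Longrightarrow> (s \<longlongrightarrow> L) U \<Longrightarrow> Lim U s = L"
  using tendsto_Lim free_ultrafilter_nat_not_bot by blast

lemma Lim_free_ultrafilter_nat_const: "free_ultrafilter_nat U \<Longrightarrow> Lim U (\<lambda>j. c) = c"
  by (rule Lim_free_ultrafilter_nat) auto

lemma Lim_free_ultrafilter_nat_add:
  fixes s t :: "nat \<Rightarrow> real"
  assumes U: "free_ultrafilter_nat U" and "\<And>j. \<bar>s j\<bar> \<le> M" and "\<And>j. \<bar>t j\<bar> \<le> N"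
  shows "Lim U (\<lambda>j. s j + t j) = Lim U s + Lim U t"
  using assms by (intro Lim_free_ultrafilter_nat tendsto_add tendsto_Lim_free_ultrafilter_nat)

lemma Lim_free_ultrafilter_nat_scale:
  fixes s :: "nat \<Rightarrow> real"
  assumes U: "free_ultrafilter_nat U" and "\<And>j. \<bar>s j\<bar> \<le> M"
  shows "Lim U (\<lambda>j. c * s j) = c * Lim U s"
  using assms by (intro Lim_free_ultrafilter_nat tendsto_mult_left tendsto_Lim_free_ultrafilter_nat)

lemma Lim_free_ultrafilter_nat_mono:
  fixes s t :: "nat \<Rightarrow> real"
  assumes U: "free_ultrafilter_nat U" and "\<And>j. \<bar>s j\<bar> \<le> M" and "\<And>j. \<bar>t j\<bar> \<le> N"
    and "\<And>j. s j \<le> t j"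
  shows "Lim U s \<le> Lim U t"
  using assms
  by (intro tendsto_le[OF free_ultrafilter_nat_not_bot tendsto_Lim_free_ultrafilter_nat
        tendsto_Lim_free_ultrafilter_nat]) auto

section \<open>Ultrapowers\<close>

lemma linf_iff: "x \<in> linf \<longleftrightarrow> (\<exists>M. \<forall>j. norm (x j) \<le> M)"
  unfolding linf_def bounded_iff by auto

lemma linf_seq_add: "x \<in> linf \<Longrightarrow> y \<in> linf \<Longrightarrow> seq_add x y \<in> linf"
  unfolding linf_iff seq_add_def by (metis add_mono norm_triangle_ineq order_trans)

lemma linf_seq_scale:
  assumes "x \<in> linf"
  shows "seq_scale c x \<in> linf"
proof -
  obtain M where M: "\<And>j. norm (x j) \<le> M" using assms linf_iff by metis
  have "norm (seq_scale c x j) \<le> \<bar>c\<bar> * M" for j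
    unfolding seq_scale_def using M[of j] by (simp add: mult_left_mono)
  then show ?thesis using linf_iff by blast
qed

lemma linf_bounded_linear_image:
  assumes "bounded_linear T" "x \<in> linf"
  shows "(\<lambda>j. T (x j)) \<in> linf"
proof -
  obtain M where M: "\<And>j. norm (x j) \<le> M" using assms(2) linf_iff by metis
  have "norm (T (x j)) \<le> onorm T * M" for j
    using onorm[OF assms(1), of "x j"] M[of j] onorm_pos_le[OF assms(1)]
    by (meson mult_left_mono order_trans)
  then show ?thesis using linf_iff by blast
qed

definition bounded_dual_family :: "(nat \<Rightarrow> 'a::real_normed_vector \<Rightarrow> real) \<Rightarrow> bool" where
  "bounded_dual_family g \<longleftrightarrow> (\<forall>j. g j \<in> normed.dual) \<and> (\<exists>B. \<forall>j. normed.dual_norm (g j) \<le> B)"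

definition ulimit_functional ::
    "nat filter \<Rightarrow> (nat \<Rightarrow> 'a::real_normed_vector \<Rightarrow> real) \<Rightarrow> (nat \<Rightarrow> 'a) \<Rightarrow> real" where
  "ulimit_functional U g x = (if x \<in> linf then Lim U (\<lambda>j. g j (x j)) else 0)"

lemma bounded_dual_family_zero: "bounded_dual_family (\<lambda>j x. 0)"
  unfolding bounded_dual_family_def using normed.dual_closed_zero normed.dual_norm_zero by auto

lemma bounded_dual_family_add:
  assumes "bounded_dual_family g" "bounded_dual_family g'"
  shows "bounded_dual_family (g + g')"
proof -
  obtain B B' where B: "\<And>j. normed.dual_norm (g j) \<le> B" "\<And>j. normed.dual_norm (g' j) \<le> B'"
    and g: "\<And>j. g j \<in> normed.dual" "\<And>j. g' j \<in> normed.dual"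
    using assms unfolding bounded_dual_family_def by blast
  have "normed.dual_norm (\<lambda>x. g j x + g' j x) \<le> B + B'" for j
    using normed.dual_norm_add_le[OF g(1,2)[of j]] B[of j] by linarith
  then show ?thesis
    unfolding bounded_dual_family_def plus_fun_def using normed.dual_closed_add[OF g(1,2)] by blast
qed

lemma bounded_dual_family_scale:
  assumes "bounded_dual_family g"
  shows "bounded_dual_family (c *\<^sub>R g)"
proof -
  obtain B where B: "\<And>j. normed.dual_norm (g j) \<le> B" and g: "\<And>j. g j \<in> normed.dual"
    using assms unfolding bounded_dual_family_def by blast
  have "normed.dual_norm (\<lambda>x. c * g j x) \<le> \<bar>c\<bar> * B" for j
    using normed.dual_norm_scale[OF g] B[of j] by (simp add: mult_left_mono)
  then show ?thesis
    unfolding bounded_dual_family_def scaleR_fun_def real_scaleR_def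
    using normed.dual_closed_scale[OF g] by blast
qed

lemma subspace_bounded_dual_family: "subspace (Collect bounded_dual_family)"
  by (simp add: subspace_def bounded_dual_family_add bounded_dual_family_scale
      bounded_dual_family_zero[folded zero_fun_def])

lemma bounded_dual_family_apply:
  assumes g: "bounded_dual_family g" and x: "x \<in> linf"
  obtains M where "\<And>j. \<bar>g j (x j)\<bar> \<le> M"
proof -
  obtain B where B: "\<And>j. normed.dual_norm (g j) \<le> B" and g: "\<And>j. g j \<in> normed.dual"
    using g unfolding bounded_dual_family_def by blast
  obtain M where M: "\<And>j. norm (x j) \<le> M" using x linf_iff by metis
  have "\<bar>g j (x j)\<bar> \<le> B * M" for j
  proof -
    have "\<bar>g j (x j)\<bar> \<le> normed.dual_norm (g j) * norm (x j)"
      by (rule normed.dual_norm_bound[OF g]) simp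
    also have "\<dots> \<le> B * M"
      using B[of j] M[of j] normed.dual_norm_nonneg[OF g]
      by (meson mult_mono norm_ge_zero order_trans)
    finally show ?thesis .
  qed
  then show ?thesis using that by blast
qed

context
  fixes U :: "nat filter"
  assumes U: "free_ultrafilter_nat U"
begin

lemma tendsto_unorm: "x \<in> linf \<Longrightarrow> ((\<lambda>j. norm (x j)) \<longlongrightarrow> unorm U x) U"
  unfolding unorm_def linf_iff by (metis U tendsto_Lim_free_ultrafilter_nat abs_norm_cancel)

lemma unorm_nonneg: "x \<in> linf \<Longrightarrow> 0 \<le> unorm U x"
  by (rule tendsto_lowerbound[OF tendsto_unorm]) (auto simp: free_ultrafilter_nat_not_bot[OF U])

lemma unorm_le:
  assumes "x \<in> linf" "y \<in> linf" "\<And>j. norm (y j) \<le> K * norm (x j)"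
  shows "unorm U y \<le> K * unorm U x"
proof (rule tendsto_le[OF free_ultrafilter_nat_not_bot[OF U]])
  show "((\<lambda>j. K * norm (x j)) \<longlongrightarrow> K * unorm U x) U"
    by (intro tendsto_mult_left tendsto_unorm assms)
  show "((\<lambda>j. norm (y j)) \<longlongrightarrow> unorm U y) U" by (rule tendsto_unorm[OF assms(2)])
qed (use assms(3) in auto)

lemma unorm_le_bound: "x \<in> linf \<Longrightarrow> (\<And>j. norm (x j) \<le> M) \<Longrightarrow> unorm U x \<le> M"
  by (rule tendsto_le[OF free_ultrafilter_nat_not_bot[OF U] tendsto_const tendsto_unorm]) auto

text \<open>This is where freeness of the ultrafilter is used.\<close>

lemma unorm_eq_0_vanishing:
  assumes x: "x \<in> linf" and le: "\<And>j. norm (x j) \<le> C / (real j + 1)"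
  shows "unorm U x = 0"
proof -
  have "((\<lambda>j. C * inverse (real (Suc j))) \<longlongrightarrow> 0) sequentially"
    by (intro tendsto_mult_right_zero LIMSEQ_inverse_real_of_nat)
  then have "((\<lambda>j. C / (real j + 1)) \<longlongrightarrow> 0) sequentially"
    by (simp add: divide_inverse add.commute)
  then have "((\<lambda>j. C / (real j + 1)) \<longlongrightarrow> 0) U"
    using free_ultrafilter_nat_le_sequentially[OF U] tendsto_mono by blast
  then have "unorm U x \<le> 0"
    by (rule tendsto_le[OF free_ultrafilter_nat_not_bot[OF U] _ tendsto_unorm[OF x]])
      (use le in auto)
  then show ?thesis using unorm_nonneg[OF x] by simp
qed

lemma unorm_seq_scale:
  assumes x: "x \<in> linf"
  shows "unorm U (seq_scale c x) = \<bar>c\<bar> * unorm U x"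
proof -
  have "((\<lambda>j. norm (seq_scale c x j)) \<longlongrightarrow> \<bar>c\<bar> * unorm U x) U"
    unfolding seq_scale_def by (simp add: tendsto_mult_left tendsto_unorm[OF x])
  then show ?thesis
    using tendsto_unorm[OF linf_seq_scale[OF x]]
      tendsto_unique[OF free_ultrafilter_nat_not_bot[OF U]] by blast
qed

lemma homogeneous_space_linf:
  "homogeneous_space (linf :: (nat \<Rightarrow> 'a::real_normed_vector) set) seq_add seq_scale (unorm U)"
proof
  show "(linf :: (nat \<Rightarrow> 'a) set) \<noteq> {}" using linf_iff[of "\<lambda>j. 0::'a"] by auto
qed (auto simp: linf_seq_add linf_seq_scale unorm_nonneg unorm_seq_scale)

lemma bounded_operator_ultrapower:
  fixes T :: "'a::real_normed_vector \<Rightarrow> 'b::real_normed_vector"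
  assumes T: "bounded_linear T"
  shows "bounded_operator (linf :: (nat \<Rightarrow> 'a) set) seq_add seq_scale (unorm U)
    (linf :: (nat \<Rightarrow> 'b) set) seq_add seq_scale (unorm U) (\<lambda>x j. T (x j)) (onorm T)"
proof (intro bounded_operator.intro homogeneous_space_linf bounded_operator_axioms.intro)
  fix x :: "nat \<Rightarrow> 'a" assume x: "x \<in> linf"
  show "(\<lambda>j. T (x j)) \<in> linf" using linf_bounded_linear_image[OF T x] .
  show "unorm U (\<lambda>j. T (x j)) \<le> onorm T * unorm U x"
    using unorm_le[OF x linf_bounded_linear_image[OF T x] onorm[OF T]] .
next
  fix x y :: "nat \<Rightarrow> 'a"
  show "(\<lambda>j. T (seq_add x y j)) = seq_add (\<lambda>j. T (x j)) (\<lambda>j. T (y j))"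
    by (simp add: seq_add_def linear_simps[OF T])
next
  fix c and x :: "nat \<Rightarrow> 'a"
  show "(\<lambda>j. T (seq_scale c x j)) = seq_scale c (\<lambda>j. T (x j))"
    by (simp add: seq_scale_def linear_simps[OF T])
qed (rule onorm_pos_le[OF T])

interpretation ultra:
  homogeneous_space "linf :: (nat \<Rightarrow> 'a::real_normed_vector) set" seq_add seq_scale "unorm U"
  by (rule homogeneous_space_linf)

lemma ulimit_functional_add:
  assumes g: "bounded_dual_family g" and g': "bounded_dual_family g'"
  shows "ulimit_functional U (\<lambda>j x. g j x + g' j x) x
    = ulimit_functional U g x + ulimit_functional U g' x"
proof (cases "x \<in> linf")
  case True
  obtain M M' where M: "\<And>j. \<bar>g j (x j)\<bar> \<le> M" and M': "\<And>j. \<bar>g' j (x j)\<bar> \<le> M'"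
    using bounded_dual_family_apply[OF g True] bounded_dual_family_apply[OF g' True] by metis
  then show ?thesis
    using True Lim_free_ultrafilter_nat_add[OF U, of "\<lambda>j. g j (x j)" M "\<lambda>j. g' j (x j)" M']
    by (simp add: ulimit_functional_def)
qed (simp add: ulimit_functional_def)

lemma ulimit_functional_scale:
  assumes g: "bounded_dual_family g"
  shows "ulimit_functional U (\<lambda>j x. c * g j x) x = c * ulimit_functional U g x"
proof (cases "x \<in> linf")
  case True
  obtain M where "\<And>j. \<bar>g j (x j)\<bar> \<le> M" using bounded_dual_family_apply[OF g True] by metis
  then show ?thesis
    using True Lim_free_ultrafilter_nat_scale[OF U, of "\<lambda>j. g j (x j)" M]
    by (simp add: ulimit_functional_def)
qed (simp add: ulimit_functional_def)

lemma ulimit_functional_in_dual: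
  assumes g: "bounded_dual_family g"
  shows "ulimit_functional U g \<in> ultra.dual"
proof -
  obtain B where B: "\<And>j. normed.dual_norm (g j) \<le> B" and gD: "\<And>j. g j \<in> normed.dual"
    using g unfolding bounded_dual_family_def by blast
  show ?thesis
  proof (rule ultra.dualI[where C = B])
    fix x y :: "nat \<Rightarrow> 'a" assume x: "x \<in> linf" and y: "y \<in> linf"
    obtain Mx My where Mx: "\<And>j. \<bar>g j (x j)\<bar> \<le> Mx" and My: "\<And>j. \<bar>g j (y j)\<bar> \<le> My"
      using bounded_dual_family_apply[OF g x] bounded_dual_family_apply[OF g y] by metis
    have "Lim U (\<lambda>j. g j (seq_add x y j)) = Lim U (\<lambda>j. g j (x j) + g j (y j))"
      by (simp add: seq_add_def normed_dualD(1)[OF gD])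
    also have "\<dots> = Lim U (\<lambda>j. g j (x j)) + Lim U (\<lambda>j. g j (y j))"
      using Lim_free_ultrafilter_nat_add[OF U, of "\<lambda>j. g j (x j)" Mx "\<lambda>j. g j (y j)" My] Mx My
      by blast
    finally show "ulimit_functional U g (seq_add x y)
        = ulimit_functional U g x + ulimit_functional U g y"
      using x y linf_seq_add[OF x y] by (simp add: ulimit_functional_def)
  next
    fix c and x :: "nat \<Rightarrow> 'a" assume x: "x \<in> linf"
    obtain M where M: "\<And>j. \<bar>g j (x j)\<bar> \<le> M" using bounded_dual_family_apply[OF g x] by metis
    have "Lim U (\<lambda>j. g j (seq_scale c x j)) = Lim U (\<lambda>j. c * g j (x j))"
      by (simp add: seq_scale_def normed_dualD(2)[OF gD])
    also have "\<dots> = c * Lim U (\<lambda>j. g j (x j))"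
      using Lim_free_ultrafilter_nat_scale[OF U, of "\<lambda>j. g j (x j)" M] M by blast
    finally show "ulimit_functional U g (seq_scale c x) = c * ulimit_functional U g x"
      using x linf_seq_scale[OF x] by (simp add: ulimit_functional_def)
  next
    fix x :: "nat \<Rightarrow> 'a" assume x: "x \<in> linf"
    obtain M where M: "\<And>j. \<bar>g j (x j)\<bar> \<le> M" using bounded_dual_family_apply[OF g x] by metis
    have le: "\<bar>g j (x j)\<bar> \<le> B * norm (x j)" for j
      using normed.dual_norm_bound[OF gD[of j], of "x j"] B[of j]
      by (meson mult_right_mono norm_ge_zero order_trans UNIV_I)
    have "((\<lambda>j. \<bar>g j (x j)\<bar>) \<longlongrightarrow> \<bar>Lim U (\<lambda>j. g j (x j))\<bar>) U"
      by (rule tendsto_rabs[OF tendsto_Lim_free_ultrafilter_nat[OF U, of _ M]]) (rule M)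
    moreover have "((\<lambda>j. B * norm (x j)) \<longlongrightarrow> B * unorm U x) U"
      by (intro tendsto_mult_left tendsto_unorm[OF x])
    ultimately have "\<bar>Lim U (\<lambda>j. g j (x j))\<bar> \<le> B * unorm U x"
      using le by (intro tendsto_le[OF free_ultrafilter_nat_not_bot[OF U]]) auto
    then show "\<bar>ulimit_functional U g x\<bar> \<le> B * unorm U x"
      using x by (simp add: ulimit_functional_def)
  qed (simp add: ulimit_functional_def)
qed

lemma linear_on_ulimit_functional: "linear_on (Collect bounded_dual_family) (ulimit_functional U)"
  by (simp add: linear_on_def fun_eq_iff plus_fun_def scaleR_fun_def ulimit_functional_add
      ulimit_functional_scale)

lemma linear_on_Lim_bidual_family:
  assumes \<Phi>: "\<And>j. \<Phi> j \<in> normed.bidual"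
    and bound: "\<And>j f. f \<in> normed.dual \<Longrightarrow> \<bar>\<Phi> j f\<bar> \<le> C * normed.dual_norm f"
  shows "linear_on (Collect bounded_dual_family) (\<lambda>g. Lim U (\<lambda>j. \<Phi> j (g j)))"
proof -
  have bounded: "\<exists>M. \<forall>j. \<bar>\<Phi> j (g j)\<bar> \<le> M" if g: "bounded_dual_family g" for g
  proof -
    obtain B where gD: "\<And>j. g j \<in> normed.dual" and B: "\<And>j. normed.dual_norm (g j) \<le> B"
      using g unfolding bounded_dual_family_def by blast
    have "\<bar>\<Phi> j (g j)\<bar> \<le> \<bar>C\<bar> * B" for j
      using bound[OF gD[of j], of j] B[of j] normed.dual_norm_nonneg[OF gD[of j]]
      by (smt (verit) abs_ge_self mult_mono mult_right_mono)
    then show ?thesis by blast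
  qed
  show ?thesis
    unfolding linear_on_def
  proof (intro conjI ballI allI)
    fix g g' :: "nat \<Rightarrow> 'a \<Rightarrow> real"
    assume g: "g \<in> Collect bounded_dual_family" and g': "g' \<in> Collect bounded_dual_family"
    obtain M where M: "\<And>j. \<bar>\<Phi> j (g j)\<bar> \<le> M" using bounded g by auto
    obtain M' where M': "\<And>j. \<bar>\<Phi> j (g' j)\<bar> \<le> M'" using bounded g' by auto
    have "\<Phi> j ((g + g') j) = \<Phi> j (g j) + \<Phi> j (g' j)" for j
      using normed.bidual_add[OF \<Phi>] g g' unfolding bounded_dual_family_def
      by (simp add: plus_fun_def)
    then show "Lim U (\<lambda>j. \<Phi> j ((g + g') j)) = Lim U (\<lambda>j. \<Phi> j (g j)) + Lim U (\<lambda>j. \<Phi> j (g' j))"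
      using Lim_free_ultrafilter_nat_add[OF U, of "\<lambda>j. \<Phi> j (g j)" M "\<lambda>j. \<Phi> j (g' j)" M'] M M'
      by simp
  next
    fix c and g :: "nat \<Rightarrow> 'a \<Rightarrow> real" assume g: "g \<in> Collect bounded_dual_family"
    obtain M where M: "\<And>j. \<bar>\<Phi> j (g j)\<bar> \<le> M" using bounded g by auto
    have "\<Phi> j ((c *\<^sub>R g) j) = c * \<Phi> j (g j)" for j
      using normed.bidual_scale[OF \<Phi>] g unfolding bounded_dual_family_def
      by (simp add: scaleR_fun_def)
    then show "Lim U (\<lambda>j. \<Phi> j ((c *\<^sub>R g) j)) = c *\<^sub>R Lim U (\<lambda>j. \<Phi> j (g j))"
      using Lim_free_ultrafilter_nat_scale[OF U, of "\<lambda>j. \<Phi> j (g j)" M] M by simp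
  qed
qed

end

section \<open>Local approximation of bidual elements\<close>

text \<open>The norm whose unit ball is the box \<open>\<parallel>u\<parallel> \<le> a, \<parallel>v\<parallel> \<le> b, \<bar>s\<bar> \<le> 1\<close>.\<close>

definition box_norm :: "real \<Rightarrow> real \<Rightarrow> 'a::real_normed_vector \<times> 'b::real_normed_vector \<times> real \<Rightarrow> real"
  where "box_norm a b z = max (norm (fst z) / a) (max (norm (fst (snd z)) / b) \<bar>snd (snd z)\<bar>)"

lemma box_norm_nonneg: "0 \<le> box_norm a b z"
  unfolding box_norm_def by (simp add: le_max_iff_disj)

lemma box_norm_minus: "box_norm a b (- z) = box_norm a b z"
  by (cases z) (simp add: box_norm_def)

lemma box_norm_add: "a > 0 \<Longrightarrow> b > 0 \<Longrightarrow> box_norm a b (z + z') \<le> box_norm a b z + box_norm a b z'"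
proof -
  assume a: "a > 0" and b: "b > 0"
  obtain u v s u' v' s' where z: "z = (u, v, s)" "z' = (u', v', s')" by (cases z, cases z') auto
  have "norm (u + u') / a \<le> norm u / a + norm u' / a"
    using divide_right_mono[OF norm_triangle_ineq[of u u'], of a] a
    by (simp add: add_divide_distrib)
  moreover have "norm (v + v') / b \<le> norm v / b + norm v' / b"
    using divide_right_mono[OF norm_triangle_ineq[of v v'], of b] b
    by (simp add: add_divide_distrib)
  moreover have "\<bar>s + s'\<bar> \<le> \<bar>s\<bar> + \<bar>s'\<bar>" by (rule abs_triangle_ineq)
  moreover have "norm u / a \<le> box_norm a b z" "norm v / b \<le> box_norm a b z" "\<bar>s\<bar> \<le> box_norm a b z"
    and "norm u' / a \<le> box_norm a b z'" "norm v' / b \<le> box_norm a b z'" "\<bar>s'\<bar> \<le> box_norm a b z'"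
    unfolding box_norm_def z by auto
  ultimately show ?thesis
    unfolding box_norm_def z fst_conv snd_conv add_Pair max.bounded_iff by (intro conjI; linarith)
qed

lemma box_norm_scale: "c \<ge> 0 \<Longrightarrow> box_norm a b (c *\<^sub>R z) = c * box_norm a b z"
  by (cases z) (simp add: box_norm_def abs_mult max_mult_distrib_left)

lemma sublinear_on_box_norm: "a > 0 \<Longrightarrow> b > 0 \<Longrightarrow> sublinear_on UNIV (box_norm a b)"
  unfolding sublinear_on_def by (simp add: box_norm_add box_norm_scale)

lemma box_norm_dual_components:
  fixes F :: "'a::real_normed_vector \<times> 'b::real_normed_vector \<times> real \<Rightarrow> real"
  assumes a: "a > 0" and b: "b > 0" and F: "linear_on UNIV F"
    and F_le: "\<And>z. F z \<le> S * box_norm a b z"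
  defines "g \<equiv> \<lambda>u. F (u, 0, 0)" and "h \<equiv> \<lambda>v. F (0, v, 0)"
  shows "g \<in> normed.dual" and "h \<in> normed.dual" and "F (u, v, s) = g u + h v + s * F (0, 0, 1)"
proof -
  have Fadd: "F (z + z') = F z + F z'" and Fscale: "F (c *\<^sub>R z) = c * F z" for z z' c
    using F by (simp_all add: linear_onD linear_on_real_scale)
  show split: "F (u, v, s) = g u + h v + s * F (0, 0, 1)" for u v s
  proof -
    have "F (u, v, s) = F ((u, 0, 0) + ((0, v, 0) + s *\<^sub>R (0, 0, 1)))" by simp
    also have "\<dots> = F (u, 0, 0) + (F (0, v, 0) + s * F (0, 0, 1))" by (simp only: Fadd Fscale)
    finally show ?thesis unfolding g_def h_def by simp
  qed
  have F_abs: "\<bar>F z\<bar> \<le> S * box_norm a b z" for z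
  proof -
    have "F (- z) = - F z" using Fscale[of "-1" z] by simp
    then show ?thesis using F_le[of z] F_le[of "- z"] by (simp add: box_norm_minus)
  qed
  have box_u: "box_norm a b (u, 0, 0) = norm u / a" and box_v: "box_norm a b (0, v, 0) = norm v / b"
    for u v using a b by (simp_all add: box_norm_def max.absorb1 max.absorb2)
  show g: "g \<in> normed.dual"
  proof (rule normed.dualI[where C = "S / a"])
    fix u u' :: 'a and c
    show "g (u + u') = g u + g u'" using Fadd[of "(u, 0, 0)" "(u', 0, 0)"] by (simp add: g_def)
    show "g (c *\<^sub>R u) = c * g u" using Fscale[of c "(u, 0, 0)"] by (simp add: g_def)
    show "\<bar>g u\<bar> \<le> S / a * norm u" using F_abs[of "(u, 0, 0)"] by (simp add: g_def box_u)
  qed simp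
  show h: "h \<in> normed.dual"
  proof (rule normed.dualI[where C = "S / b"])
    fix v v' :: 'b and c
    show "h (v + v') = h v + h v'" using Fadd[of "(0, v, 0)" "(0, v', 0)"] by (simp add: h_def)
    show "h (c *\<^sub>R v) = c * h v" using Fscale[of c "(0, v, 0)"] by (simp add: h_def)
    show "\<bar>h v\<bar> \<le> S / b * norm v" using F_abs[of "(0, v, 0)"] by (simp add: h_def box_v)
  qed simp
qed

text \<open>The dual norm of the box norm is the weighted \<open>\<ell>\<^sub>1\<close> norm
  \<open>a \<parallel>g\<parallel> + b \<parallel>h\<parallel> + \<bar>\<nu>\<bar>\<close>.\<close>

lemma box_norm_dual_norm_le:
  fixes F :: "'a::real_normed_vector \<times> 'b::real_normed_vector \<times> real \<Rightarrow> real"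
  assumes a: "a > 0" and b: "b > 0" and F: "linear_on UNIV F"
    and F_le: "\<And>z. F z \<le> S * box_norm a b z"
  defines "g \<equiv> \<lambda>u. F (u, 0, 0)" and "h \<equiv> \<lambda>v. F (0, v, 0)"
  shows "a * normed.dual_norm g + b * normed.dual_norm h + \<bar>F (0, 0, 1)\<bar> \<le> S"
proof -
  note g = box_norm_dual_components(1)[OF a b F F_le, folded g_def h_def]
    and h = box_norm_dual_components(2)[OF a b F F_le, folded g_def h_def]
    and split = box_norm_dual_components(3)[OF a b F F_le, folded g_def h_def]
  define \<nu> where "\<nu> = F (0, 0, 1)"
  have "F (0, 0, -1) = - F (0, 0, 1)" using linear_on_real_scale[OF F, of "(0, 0, 1)" "-1"] by simp
  then have S: "0 \<le> S" using F_le[of "(0, 0, 1)"] F_le[of "(0, 0, -1)"] by (simp add: box_norm_def)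
  have inner: "a * \<bar>g u\<bar> + b * \<bar>h v\<bar> + \<bar>\<nu>\<bar> \<le> S" if u: "norm u \<le> 1" and v: "norm v \<le> 1" for u v
  proof -
    define u' where "u' = (a * sgn (g u)) *\<^sub>R u"
    define v' where "v' = (b * sgn (h v)) *\<^sub>R v"
    have "F (u', v', sgn \<nu>) = g u' + h v' + sgn \<nu> * \<nu>"
      using split[of u' v' "sgn \<nu>"] by (simp add: \<nu>_def g_def h_def)
    also have "\<dots> = a * \<bar>g u\<bar> + b * \<bar>h v\<bar> + \<bar>\<nu>\<bar>"
      unfolding u'_def v'_def using normed_dualD(2)[OF g] normed_dualD(2)[OF h]
      by (simp add: abs_sgn mult.commute mult.left_commute)
    finally have "a * \<bar>g u\<bar> + b * \<bar>h v\<bar> + \<bar>\<nu>\<bar> = F (u', v', sgn \<nu>)" ..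
    also have "\<dots> \<le> S * box_norm a b (u', v', sgn \<nu>)" by (rule F_le)
    also have "\<dots> \<le> S * 1"
    proof (rule mult_left_mono[OF _ S])
      show "box_norm a b (u', v', sgn \<nu>) \<le> 1"
        unfolding box_norm_def u'_def v'_def using a b u v
        by (auto simp: abs_mult abs_sgn_eq mult_le_one)
    qed
    finally show ?thesis by simp
  qed
  have "b * normed.dual_norm h \<le> S - \<bar>\<nu>\<bar> - a * \<bar>g u\<bar>" if u: "norm u \<le> 1" for u
  proof -
    have "normed.dual_norm h \<le> (S - \<bar>\<nu>\<bar> - a * \<bar>g u\<bar>) / b"
    proof (rule normed.dual_norm_least)
      fix v :: 'b assume "norm v \<le> 1"
      then have "b * \<bar>h v\<bar> \<le> S - \<bar>\<nu>\<bar> - a * \<bar>g u\<bar>" using inner[OF u] by fastforce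
      then show "\<bar>h v\<bar> \<le> (S - \<bar>\<nu>\<bar> - a * \<bar>g u\<bar>) / b" using b by (simp add: le_divide_eq mult.commute)
    qed
    then show ?thesis using b by (simp add: le_divide_eq mult.commute)
  qed
  then have "normed.dual_norm g \<le> (S - \<bar>\<nu>\<bar> - b * normed.dual_norm h) / a"
    by (intro normed.dual_norm_least) (use a in \<open>fastforce simp: le_divide_eq mult.commute\<close>)
  then show "a * normed.dual_norm g + b * normed.dual_norm h + \<bar>F (0, 0, 1)\<bar> \<le> S"
    using a by (simp add: le_divide_eq mult.commute \<nu>_def)
qed

context
  fixes T :: "'a::real_normed_vector \<Rightarrow> 'b::real_normed_vector"
  assumes T: "bounded_linear T"
begin

interpretation T: bounded_linear T by (rule T)

interpretation N:
  bounded_operator "UNIV :: 'a set" "(+)" "(*\<^sub>R)" norm "UNIV :: 'b set" "(+)" "(*\<^sub>R)" norm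
    T "onorm T"
  by (rule bounded_operator_normed[OF T])

definition in_bidual_balls :: "real \<Rightarrow> real \<Rightarrow> (('a \<Rightarrow> real) \<Rightarrow> real) \<Rightarrow> 'b \<Rightarrow> bool" where
  "in_bidual_balls a b \<Phi> w \<longleftrightarrow> \<Phi> \<in> normed.bidual \<and>
     (\<forall>f \<in> normed.dual. \<bar>\<Phi> f\<bar> \<le> a * normed.dual_norm f) \<and>
     (\<forall>h \<in> normed.dual. \<bar>N.biadj \<Phi> h - h w\<bar> \<le> b * normed.dual_norm h)"

lemma box_bound_homogeneous:
  assumes a: "a > 0" and b: "b > 0" and g: "g \<in> normed.dual"
    and H: "\<And>x t. norm x \<le> a \<Longrightarrow> norm (T x - t *\<^sub>R w) \<le> b \<Longrightarrow> \<bar>t\<bar> \<le> 1 \<Longrightarrow> g x + \<mu> * t \<le> S"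
  shows "g x + \<mu> * t \<le> S * box_norm a b (x, T x - t *\<^sub>R w, t)"
proof -
  define n where "n = box_norm a b (x, T x - t *\<^sub>R w, t)"
  have n1: "norm x / a \<le> n" and n2: "norm (T x - t *\<^sub>R w) / b \<le> n" and n3: "\<bar>t\<bar> \<le> n"
    by (auto simp: n_def box_norm_def)
  show ?thesis
  proof (cases "n = 0")
    case True
    then have "x = 0" "t = 0" using n1 n3 a by (auto simp: divide_le_0_iff)
    then show ?thesis using H[of 0 0] a b by (simp add: normed_dualD[OF g] box_norm_nonneg)
  next
    case False
    then have n: "n > 0" using n3 by linarith
    have "norm ((1 / n) *\<^sub>R x) \<le> a"
      using n1 n a by (simp add: divide_le_eq mult.commute)
    moreover have "T ((1 / n) *\<^sub>R x) - (t / n) *\<^sub>R w = (1 / n) *\<^sub>R (T x - t *\<^sub>R w)"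
      by (simp add: T.scaleR scaleR_diff_right)
    then have "norm (T ((1 / n) *\<^sub>R x) - (t / n) *\<^sub>R w) \<le> b"
      using n2 n b by (simp add: divide_le_eq mult.commute)
    moreover have "\<bar>t / n\<bar> \<le> 1" using n3 n by simp
    ultimately have "g ((1 / n) *\<^sub>R x) + \<mu> * (t / n) \<le> S" by (rule H)
    then have "(g x + \<mu> * t) / n \<le> S" by (simp add: normed_dualD[OF g] add_divide_distrib)
    then show ?thesis using n by (simp add: divide_le_eq n_def mult.commute)
  qed
qed

text \<open>By Hahn--Banach, \<open>(x, t) \<mapsto> g x + \<mu> t\<close> extends along \<open>(x, t) \<mapsto> (x, T x - t w, t)\<close> to a
  functional on \<open>X \<times> Y \<times> \<real>\<close> dominated by \<open>S\<close> times the box norm; pairing its three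
  components with \<open>\<Phi>\<close>, \<open>T\<^sup>*\<^sup>*\<Phi> - w\<close> and \<open>1\<close> gives the bound.\<close>

lemma bidual_le_of_box_bound:
  assumes \<Phi>: "in_bidual_balls a b \<Phi> w" and a: "a > 0" and b: "b > 0" and g: "g \<in> normed.dual"
    and H: "\<And>x t. norm x \<le> a \<Longrightarrow> norm (T x - t *\<^sub>R w) \<le> b \<Longrightarrow> \<bar>t\<bar> \<le> 1 \<Longrightarrow> g x + \<mu> * t \<le> S"
  shows "\<Phi> g + \<mu> \<le> S"
proof -
  note glin = normed_dualD[OF g]
  have S: "0 \<le> S" using H[of 0 0] a b by (simp add: glin)
  define ell where "ell z = (fst z, T (fst z) - snd z *\<^sub>R w, snd z)" for z :: "'a \<times> real"
  define phi where "phi z = g (fst z) + \<mu> * snd z" for z :: "'a \<times> real"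
  have phi_le: "phi z \<le> S * box_norm a b (ell z)" for z
    using box_bound_homogeneous[OF a b g H] by (simp add: phi_def ell_def)
  have ell: "linear_on UNIV ell"
    unfolding linear_on_def ell_def by (simp add: T.add T.scaleR scaleR_add_left scaleR_diff_right)
  have phi: "linear_on UNIV phi"
    unfolding linear_on_def phi_def by (simp add: glin distrib_left)
  obtain F where F: "linear_on UNIV F" and F_ell: "\<And>z. F (ell z) = phi z"
    and F_le: "\<And>z. F z \<le> S * box_norm a b z"
    by (rule hahn_banach_image[OF subspace_UNIV subspace_UNIV ell subset_UNIV phi
          sublinear_on_scale[OF sublinear_on_box_norm[OF a b] S] phi_le]) blast+
  define g1 where "g1 u = F (u, 0, 0)" for u
  define h where "h v = F (0, v, 0)" for v
  note split = box_norm_dual_components[OF a b F F_le, folded g1_def h_def]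
    box_norm_dual_norm_le[OF a b F F_le, folded g1_def h_def]
  have g_split: "g = (\<lambda>x. g1 x + N.adj h x)"
  proof
    fix x
    have "g x = F (ell (x, 0))" by (simp add: F_ell phi_def)
    then show "g x = g1 x + N.adj h x" using split(3)[of x "T x" 0] by (simp add: ell_def)
  qed
  have \<mu>_split: "\<mu> = F (0, 0, 1) - h w"
  proof -
    have "\<mu> = F (ell (0, 1))" by (simp add: F_ell phi_def glin)
    then show ?thesis
      using split(3)[of 0 "- w" 1] normed_dualD(3)[OF split(1)] normed_dualD(4)[OF split(2)]
      by (simp add: ell_def T.zero)
  qed
  have "\<Phi> g = \<Phi> g1 + N.biadj \<Phi> h"
    using \<Phi> g_split normed.bidual_add[of \<Phi> g1 "N.adj h"] N.adj_in_dual[OF split(2)]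
      N.biadj_apply[OF split(2)] split(1) by (simp add: in_bidual_balls_def)
  then have "\<Phi> g + \<mu> = \<Phi> g1 + (N.biadj \<Phi> h - h w) + F (0, 0, 1)" by (simp add: \<mu>_split)
  also have "\<dots> \<le> a * normed.dual_norm g1 + b * normed.dual_norm h + \<bar>F (0, 0, 1)\<bar>"
    using \<Phi> split(1,2) unfolding in_bidual_balls_def by (intro add_mono) auto
  also have "\<dots> \<le> S" by (rule split(4))
  finally show ?thesis .
qed

text \<open>Taking \<open>\<mu>\<close> large in the separation forces a point of the box with \<open>t\<close> close to \<open>1\<close>.\<close>

lemma box_point_near_top:
  assumes \<Phi>: "in_bidual_balls a b \<Phi> w" and a: "a > 0" and b: "b > 0" and g: "g \<in> normed.dual"
    and \<delta>: "\<delta> > 0" and \<eta>: "\<eta> > 0"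
  obtains x t where "norm x \<le> a" "norm (T x - t *\<^sub>R w) \<le> b" "\<bar>t\<bar> \<le> 1" "1 - t < \<delta>"
    "\<Phi> g - \<eta> < g x"
proof -
  define Q where "Q = normed.dual_norm g * a + \<bar>\<Phi> g\<bar> + \<eta>"
  have Q: "Q > 0" using normed.dual_norm_nonneg[OF g] a \<eta> by (simp add: Q_def add_nonneg_pos)
  define M where "M = Q / \<delta>"
  have "\<exists>x t. norm x \<le> a \<and> norm (T x - t *\<^sub>R w) \<le> b \<and> \<bar>t\<bar> \<le> 1 \<and> \<Phi> g + M - \<eta> < g x + M * t"
  proof (rule ccontr)
    assume "\<not> ?thesis"
    then have "\<Phi> g + M \<le> \<Phi> g + M - \<eta>"
      by (intro bidual_le_of_box_bound[OF \<Phi> a b g]) (auto simp: not_less)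
    then show False using \<eta> by simp
  qed
  then obtain x t where x: "norm x \<le> a" and xt: "norm (T x - t *\<^sub>R w) \<le> b" and t: "\<bar>t\<bar> \<le> 1"
    and big: "\<Phi> g + M - \<eta> < g x + M * t"
    by blast
  have "\<bar>g x\<bar> \<le> normed.dual_norm g * a"
    using normed.dual_norm_bound[OF g, of x] x normed.dual_norm_nonneg[OF g]
    by simp (meson mult_left_mono order_trans)
  moreover have "M * (1 - t) = M - M * t" "g x \<le> \<bar>g x\<bar>" "- \<Phi> g \<le> \<bar>\<Phi> g\<bar>"
    by (auto simp: algebra_simps)
  ultimately have "M * (1 - t) < Q" using big unfolding Q_def by linarith
  then have "Q * ((1 - t) / \<delta>) < Q * 1" by (simp add: M_def algebra_simps)
  then have "(1 - t) / \<delta> < 1" using Q by (simp only: mult_less_cancel_left_pos)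
  then have "1 - t < \<delta>" using \<delta> by (simp add: divide_less_eq)
  moreover have "0 \<le> M * (1 - t)" using Q \<delta> t by (simp add: M_def)
  then have "\<Phi> g - \<eta> < g x" using big by (simp add: algebra_simps)
  ultimately show ?thesis using that x xt t by blast
qed

lemma rescale_box_point:
  assumes x: "norm x \<le> a" and xt: "norm (T x - t *\<^sub>R w) \<le> b" and t: "t > 0"
    and ta: "a \<le> a' * t" and tb: "b \<le> b' * t"
  shows "norm ((1 / t) *\<^sub>R x) \<le> a'" and "norm (T ((1 / t) *\<^sub>R x) - w) \<le> b'"
proof -
  have "norm ((1 / t) *\<^sub>R x) = norm x / t" using t by simp
  also have "\<dots> \<le> a'" using x ta t by (simp add: divide_le_eq mult.commute)
  finally show "norm ((1 / t) *\<^sub>R x) \<le> a'" .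
  have "T ((1 / t) *\<^sub>R x) - w = (1 / t) *\<^sub>R (T x - t *\<^sub>R w)"
    using t by (simp add: T.scaleR scaleR_diff_right)
  then have "norm (T ((1 / t) *\<^sub>R x) - w) = norm (T x - t *\<^sub>R w) / t" using t by simp
  also have "\<dots> \<le> b'" using xt tb t by (simp add: divide_le_eq mult.commute)
  finally show "norm (T ((1 / t) *\<^sub>R x) - w) \<le> b'" .
qed

lemma approximate_from_above:
  assumes \<Phi>: "in_bidual_balls a b \<Phi> w" and a: "a > 0" and b: "b > 0" and g: "g \<in> normed.dual"
    and a': "a < a'" and b': "b < b'" and c: "c < \<Phi> g"
  shows "\<exists>x. norm x \<le> a' \<and> norm (T x - w) \<le> b' \<and> c < g x"
proof -
  define \<eta> where "\<eta> = \<Phi> g - c"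
  have \<eta>: "\<eta> > 0" using c by (simp add: \<eta>_def)
  define Ga where "Ga = normed.dual_norm g * a"
  have Ga: "Ga \<ge> 0" using normed.dual_norm_nonneg[OF g] a by (simp add: Ga_def)
  define \<delta> where "\<delta> = min (1/2) (min (1 - a/a') (min (1 - b/b') (\<eta> / (4 * Ga + 1))))"
  have \<delta>: "\<delta> > 0" unfolding \<delta>_def using a a' b b' \<eta> Ga by simp
  have \<delta>_le: "\<delta> \<le> 1/2" "\<delta> \<le> 1 - a/a'" "\<delta> \<le> 1 - b/b'" "\<delta> \<le> \<eta> / (4 * Ga + 1)"
    unfolding \<delta>_def by linarith+
  obtain x t where x: "norm x \<le> a" and xt: "norm (T x - t *\<^sub>R w) \<le> b" and t: "\<bar>t\<bar> \<le> 1"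
    and t_near: "1 - t < \<delta>" and gx_big: "\<Phi> g - \<eta>/2 < g x"
    using box_point_near_top[OF \<Phi> a b g \<delta>, of "\<eta>/2"] \<eta> by auto
  have t_half: "t \<ge> 1/2" and "a / a' \<le> t" and "b / b' \<le> t" using t_near \<delta>_le by linarith+
  then have "a \<le> a' * t" and "b \<le> b' * t"
    using a a' b b' by (simp_all add: divide_le_eq mult.commute)
  note x' = rescale_box_point[OF x xt _ this]
  have gx: "\<bar>g x\<bar> \<le> Ga"
    using normed.dual_norm_bound[OF g, of x] x normed.dual_norm_nonneg[OF g]
    by (simp add: Ga_def) (meson mult_left_mono order_trans)
  have "g ((1 / t) *\<^sub>R x) - g x = g x * (1 - t) / t"
    using t_half by (simp add: normed_dualD(2)[OF g] field_simps)
  then have "\<bar>g ((1 / t) *\<^sub>R x) - g x\<bar> = \<bar>g x\<bar> * (1 - t) / t"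
    using t_half t by (simp add: abs_mult)
  also have "\<dots> \<le> Ga * \<delta> * 2"
  proof -
    have "\<bar>g x\<bar> * (1 - t) \<le> Ga * \<delta>" using gx t_near t Ga by (intro mult_mono) auto
    moreover have "Ga * \<delta> \<le> Ga * \<delta> * (2 * t)"
      using t_half Ga \<delta> mult_left_mono[of 1 "2 * t" "Ga * \<delta>"] by simp
    ultimately show ?thesis using t_half by (simp add: divide_le_eq mult.assoc mult.left_commute)
  qed
  also have "\<dots> < \<eta> / 2"
  proof -
    have "Ga * \<delta> * 2 \<le> Ga * (\<eta> / (4 * Ga + 1)) * 2"
      using mult_right_mono[OF mult_left_mono[OF \<delta>_le(4) Ga], of 2] by simp
    also have "\<dots> < \<eta> / 2" using Ga \<eta> by (simp add: field_simps)
    finally show ?thesis .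
  qed
  finally have "g x - \<eta> / 2 < g ((1 / t) *\<^sub>R x)" by (auto simp only: abs_less_iff)
  then have "\<Phi> g - \<eta> < g ((1 / t) *\<^sub>R x)" using gx_big by linarith
  then show ?thesis using x' t_half by (intro exI[of _ "(1 / t) *\<^sub>R x"]) (simp add: \<eta>_def)
qed

lemma convex_combination_in_box:
  assumes "norm x1 \<le> a'" "norm (T x1 - w) \<le> b'" "norm x2 \<le> a'" "norm (T x2 - w) \<le> b'"
    and l: "0 \<le> l" "l \<le> 1"
  shows "norm (l *\<^sub>R x1 + (1 - l) *\<^sub>R x2) \<le> a'" and "norm (T (l *\<^sub>R x1 + (1 - l) *\<^sub>R x2) - w) \<le> b'"
proof -
  have "l *\<^sub>R x1 + (1 - l) *\<^sub>R x2 \<in> cball 0 a'"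
    using assms by (intro convexD[OF convex_cball]) auto
  then show "norm (l *\<^sub>R x1 + (1 - l) *\<^sub>R x2) \<le> a'" by simp
  have "T (l *\<^sub>R x1 + (1 - l) *\<^sub>R x2) = l *\<^sub>R T x1 + (1 - l) *\<^sub>R T x2"
    by (simp only: T.add T.scaleR)
  then have "T (l *\<^sub>R x1 + (1 - l) *\<^sub>R x2) - w = l *\<^sub>R (T x1 - w) + (1 - l) *\<^sub>R (T x2 - w)"
    by (simp add: algebra_simps)
  moreover have "l *\<^sub>R (T x1 - w) + (1 - l) *\<^sub>R (T x2 - w) \<in> cball 0 b'"
    using assms by (intro convexD[OF convex_cball]) auto
  ultimately show "norm (T (l *\<^sub>R x1 + (1 - l) *\<^sub>R x2) - w) \<le> b'" by simp
qed

text \<open>Approximation from both sides, combined by a convex combination.\<close>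

lemma bidual_local_approximation:
  assumes \<Phi>: "in_bidual_balls a b \<Phi> w" and a: "a > 0" and b: "b > 0" and g: "g \<in> normed.dual"
    and a': "a < a'" and b': "b < b'" and \<epsilon>: "\<epsilon> > 0"
  shows "\<exists>x. norm x \<le> a' \<and> norm (T x - w) \<le> b' \<and> \<bar>g x - \<Phi> g\<bar> < \<epsilon>"
proof -
  obtain x1 where x1: "norm x1 \<le> a'" "norm (T x1 - w) \<le> b'" "\<Phi> g - \<epsilon> < g x1"
    using approximate_from_above[OF \<Phi> a b g a' b', of "\<Phi> g - \<epsilon>"] \<epsilon> by auto
  have "\<Phi> (\<lambda>x. (-1) * g x) = - \<Phi> g"
    using \<Phi> normed.bidual_scale[OF _ g, of \<Phi> "-1"] by (simp add: in_bidual_balls_def)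
  then obtain x2 where x2: "norm x2 \<le> a'" "norm (T x2 - w) \<le> b'" "g x2 < \<Phi> g + \<epsilon>"
    using approximate_from_above[OF \<Phi> a b normed.dual_closed_scale[OF g, of "-1"] a' b',
        of "- \<Phi> g - \<epsilon>"] \<epsilon>
    by auto
  show ?thesis
  proof (cases "g x1 < \<Phi> g + \<epsilon>")
    case True
    then show ?thesis using x1 by (intro exI[of _ x1]) auto
  next
    case x1_high: False
    show ?thesis
    proof (cases "\<Phi> g - \<epsilon> < g x2")
      case True
      then show ?thesis using x2 by (intro exI[of _ x2]) auto
    next
      case x2_low: False
      define l where "l = (\<Phi> g - g x2) / (g x1 - g x2)"
      have gap: "g x1 - g x2 > 0" using x1_high x2_low \<epsilon> by linarith
      have l: "0 \<le> l" "l \<le> 1" unfolding l_def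
        using x1_high x2_low gap \<epsilon> by (auto simp: divide_le_eq)
      have "g (l *\<^sub>R x1 + (1 - l) *\<^sub>R x2) = g x2 + l * (g x1 - g x2)"
        by (simp add: normed_dualD[OF g] algebra_simps)
      then have "g (l *\<^sub>R x1 + (1 - l) *\<^sub>R x2) = \<Phi> g" using gap by (simp add: l_def)
      then show ?thesis
        using convex_combination_in_box[OF x1(1,2) x2(1,2) l] \<epsilon> by (intro exI) auto
    qed
  qed
qed

section \<open>Normalised witnesses of failure of strong Tauberianity\<close>

text \<open>A normalised witness that \<open>T\<^sup>*\<^sup>*\<close> does not induce an isomorphism on \<open>X\<^sup>*\<^sup>*/X\<close>:
  \<open>\<Phi>\<close> has norm at most \<open>2\<close> and distance more than \<open>1/2\<close> from \<open>X\<close>, while \<open>T\<^sup>*\<^sup>*\<Phi>\<close> lies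
  within \<open>c\<close> of the point \<open>w\<close> of \<open>Y\<close>.\<close>

definition tauberian_defect :: "real \<Rightarrow> (('a \<Rightarrow> real) \<Rightarrow> real) \<Rightarrow> 'b \<Rightarrow> bool" where
  "tauberian_defect c \<Phi> w \<longleftrightarrow> in_bidual_balls 2 c \<Phi> w \<and>
     (\<forall>x. \<exists>f \<in> normed.dual. normed.dual_norm f \<le> 1 \<and> 1/2 < \<bar>\<Phi> f - f x\<bar>)"

lemma tauberian_defect_rescale:
  assumes \<Phi>: "\<Phi> \<in> normed.bidual" and d: "d > 0"
    and dist: "\<And>x. d \<le> normed.bidual_norm (\<lambda>f. \<Phi> f - normed.canon x f)"
    and x0: "normed.bidual_norm (\<lambda>f. \<Phi> f - normed.canon x0 f) < 2 * d"
    and y0: "normed.bidual_norm (\<lambda>g. N.biadj \<Phi> g - normed.canon y0 g) < c * d"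
  shows "tauberian_defect c (\<lambda>f. (1/d) * (\<Phi> f - normed.canon x0 f)) ((1/d) *\<^sub>R (y0 - T x0))"
proof -
  define \<Phi>_x where "\<Phi>_x x = (\<lambda>f. \<Phi> f - normed.canon x f)" for x
  define \<Psi>_y where "\<Psi>_y y = (\<lambda>g. N.biadj \<Phi> g - normed.canon y g)" for y
  have \<Phi>_x: "\<Phi>_x x \<in> normed.bidual" for x
    unfolding \<Phi>_x_def by (rule normed.bidual_closed_diff[OF \<Phi> normed.canon_in_bidual]) simp
  have \<Psi>_y: "\<Psi>_y y \<in> normed.bidual" for y
    unfolding \<Psi>_y_def
    by (rule normed.bidual_closed_diff[OF N.biadj_in_bidual[OF \<Phi>] normed.canon_in_bidual]) simp
  define \<Phi>' where "\<Phi>' f = (1/d) * \<Phi>_x x0 f" for f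
  define w where "w = (1/d) *\<^sub>R (y0 - T x0)"
  have \<Phi>': "\<Phi>' \<in> normed.bidual" unfolding \<Phi>'_def by (rule normed.bidual_closed_scale[OF \<Phi>_x])
  have norm_\<Phi>': "\<bar>\<Phi>' f\<bar> \<le> 2 * normed.dual_norm f" if f: "f \<in> normed.dual" for f
  proof -
    have "\<bar>\<Phi>_x x0 f\<bar> \<le> normed.bidual_norm (\<Phi>_x x0) * normed.dual_norm f"
      by (rule normed.bidual_norm_bound[OF \<Phi>_x f])
    also have "\<dots> \<le> (2 * d) * normed.dual_norm f"
      using x0[folded \<Phi>_x_def] normed.dual_norm_nonneg[OF f] by (simp add: mult_right_mono)
    finally show ?thesis unfolding \<Phi>'_def using d by (simp add: abs_mult divide_le_eq ac_simps)
  qed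
  have far_\<Phi>': "\<exists>f \<in> normed.dual. normed.dual_norm f \<le> 1 \<and> 1/2 < \<bar>\<Phi>' f - f x\<bar>" for x
  proof -
    define x1 where "x1 = x0 + d *\<^sub>R x"
    have "d \<le> normed.bidual_norm (\<Phi>_x x1)" using dist[of x1] by (simp add: \<Phi>_x_def)
    then have "d/2 < normed.bidual_norm (\<Phi>_x x1)" using d by simp
    then obtain f where f: "f \<in> normed.dual" "normed.dual_norm f \<le> 1" "d/2 < \<bar>\<Phi>_x x1 f\<bar>"
      using normed.bidual_norm_approx[OF \<Phi>_x] by blast
    have "\<Phi>' f - f x = (1/d) * \<Phi>_x x1 f"
      using d by (simp add: \<Phi>'_def \<Phi>_x_def x1_def normed.canon_apply[OF f(1)] normed_dualD[OF f(1)]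
          field_simps)
    then have "\<bar>\<Phi>' f - f x\<bar> = \<bar>\<Phi>_x x1 f\<bar> / d" using d by (simp add: abs_mult)
    then have "d * (2 * \<bar>\<Phi>' f - f x\<bar>) = 2 * \<bar>\<Phi>_x x1 f\<bar>" using d by simp
    then have "d * 1 < d * (2 * \<bar>\<Phi>' f - f x\<bar>)" using f(3) by linarith
    then have "1/2 < \<bar>\<Phi>' f - f x\<bar>" using d by (simp only: mult_less_cancel_left_pos) simp
    then show ?thesis using f by blast
  qed
  have close_\<Phi>': "\<bar>N.biadj \<Phi>' h - h w\<bar> \<le> c * normed.dual_norm h" if h: "h \<in> normed.dual" for h
  proof -
    have "N.biadj \<Phi>' h - h w = (1/d) * \<Psi>_y y0 h"
      using N.biadj_apply[OF h] normed.canon_apply[OF N.adj_in_dual[OF h]] normed.canon_apply[OF h]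
      by (simp add: \<Phi>'_def \<Phi>_x_def \<Psi>_y_def w_def normed_dualD[OF h] algebra_simps)
    then have "\<bar>N.biadj \<Phi>' h - h w\<bar> = \<bar>\<Psi>_y y0 h\<bar> / d" using d by (simp add: abs_mult)
    also have "\<dots> \<le> normed.bidual_norm (\<Psi>_y y0) * normed.dual_norm h / d"
      using normed.bidual_norm_bound[OF \<Psi>_y h] d by (simp add: divide_right_mono)
    also have "\<dots> \<le> (c * d) * normed.dual_norm h / d"
      using y0[folded \<Psi>_y_def] normed.dual_norm_nonneg[OF h] d
      by (intro divide_right_mono mult_right_mono) auto
    also have "\<dots> = c * normed.dual_norm h" using d by simp
    finally show ?thesis .
  qed
  have "(\<lambda>f. (1/d) * (\<Phi> f - normed.canon x0 f)) = \<Phi>'" by (simp add: fun_eq_iff \<Phi>'_def \<Phi>_x_def)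
  then show ?thesis
    unfolding w_def[symmetric] tauberian_defect_def in_bidual_balls_def
    using \<Phi>' norm_\<Phi>' far_\<Phi>' close_\<Phi>' by blast
qed

lemma tauberian_defect_if_not_strongly_tauberian:
  assumes "\<not> strongly_tauberian T" and c: "c > 0"
  shows "\<exists>\<Phi> w. tauberian_defect c \<Phi> w"
proof -
  obtain \<Phi> where \<Phi>: "\<Phi> \<in> normed.bidual" and lt:
    "(INF y. normed.bidual_norm (\<lambda>g. N.biadj \<Phi> g - normed.canon y g))
       < c * (INF x. normed.bidual_norm (\<lambda>f. \<Phi> f - normed.canon x f))"
    using assms unfolding strongly_tauberian_def sstrongly_tauberian_def by (auto simp: not_le)
  have bidual_diff: "(\<lambda>f. \<Psi> f - normed.canon x f) \<in> normed.bidual" if "\<Psi> \<in> normed.bidual" for \<Psi> x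
    by (rule normed.bidual_closed_diff[OF that normed.canon_in_bidual]) simp
  have bdd_x: "bdd_below (range (\<lambda>x. normed.bidual_norm (\<lambda>f. \<Phi> f - normed.canon x f)))"
    using normed.bidual_norm_nonneg[OF bidual_diff[OF \<Phi>]] unfolding bdd_below_def by blast
  have bdd_y: "bdd_below (range (\<lambda>y. normed.bidual_norm (\<lambda>g. N.biadj \<Phi> g - normed.canon y g)))"
    using normed.bidual_norm_nonneg[OF bidual_diff[OF N.biadj_in_bidual[OF \<Phi>]]]
    unfolding bdd_below_def by blast
  define d where "d = (INF x. normed.bidual_norm (\<lambda>f. \<Phi> f - normed.canon x f))"
  have "0 \<le> (INF y. normed.bidual_norm (\<lambda>g. N.biadj \<Phi> g - normed.canon y g))"
    using normed.bidual_norm_nonneg[OF bidual_diff[OF N.biadj_in_bidual[OF \<Phi>]]]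
    by (intro cINF_greatest) auto
  moreover have "c * d \<le> 0" if "\<not> d > 0" using c that by (simp add: mult_nonneg_nonpos)
  ultimately have d: "d > 0" using lt unfolding d_def by linarith
  obtain x0 where x0: "normed.bidual_norm (\<lambda>f. \<Phi> f - normed.canon x0 f) < 2 * d"
    using cINF_less_iff[OF UNIV_not_empty bdd_x, of "2 * d"] d unfolding d_def by auto
  obtain y0 where y0: "normed.bidual_norm (\<lambda>g. N.biadj \<Phi> g - normed.canon y0 g) < c * d"
    using cINF_less_iff[OF UNIV_not_empty bdd_y, of "c * d"] lt unfolding d_def by auto
  have "d \<le> normed.bidual_norm (\<lambda>f. \<Phi> f - normed.canon x f)" for x
    unfolding d_def by (rule cINF_lower[OF bdd_x]) simp
  then show ?thesis using tauberian_defect_rescale[OF \<Phi> d _ x0 y0] by blast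
qed

lemma defect_local_approximation:
  assumes "tauberian_defect (1 / (real j + 1)) \<Phi> w" and "g \<in> normed.dual" and "\<epsilon> > 0"
  shows "\<exists>x. norm x \<le> 3 \<and> norm (T x - w) \<le> 2 / (real j + 1) \<and> \<bar>g x - \<Phi> g\<bar> < \<epsilon>"
  using bidual_local_approximation[of 2 "1 / (real j + 1)" \<Phi> w g 3 "2 / (real j + 1)" \<epsilon>] assms
  by (auto simp: tauberian_defect_def divide_strict_right_mono)

lemma norm_defect_point_le:
  assumes "tauberian_defect (1 / (real j + 1)) \<Phi> w"
  shows "norm w \<le> 3 * onorm T + 2"
proof -
  obtain x where x: "norm x \<le> 3" "norm (T x - w) \<le> 2 / (real j + 1)"
    using defect_local_approximation[OF assms normed.dual_closed_zero, of 1] by auto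
  have "norm (T x) \<le> 3 * onorm T"
    using onorm[OF T, of x] mult_left_mono[OF x(1) onorm_pos_le[OF T]] by (simp add: mult.commute)
  moreover have "2 / (real j + 1) \<le> 2" by (simp add: divide_le_eq)
  moreover have "norm w \<le> norm (T x) + norm (T x - w)"
    by (metis norm_triangle_sub norm_minus_commute)
  ultimately show ?thesis using x(2) by linarith
qed

text \<open>Multiplying the witnesses of distance by signs turns the gap \<open>1/2 < \<bar>\<Phi>\<^sub>j f\<^sub>j - f\<^sub>j(u\<^sub>j)\<bar>\<close>
  into a one-sided gap for a bounded family.\<close>

lemma defect_separating_family:
  assumes defects: "\<And>j. tauberian_defect (c j) (\<Phi> j) (W j)"
  shows "\<exists>g. bounded_dual_family g \<and> (\<forall>j. \<bar>\<Phi> j (g j)\<bar> \<le> 2) \<and>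
    (\<forall>j. g j (u j) + 1/2 \<le> \<Phi> j (g j))"
proof -
  have \<Phi>: "\<Phi> j \<in> normed.bidual" "\<And>f. f \<in> normed.dual \<Longrightarrow> \<bar>\<Phi> j f\<bar> \<le> 2 * normed.dual_norm f"
    and far: "\<And>x. \<exists>f \<in> normed.dual. normed.dual_norm f \<le> 1 \<and> 1/2 < \<bar>\<Phi> j f - f x\<bar>" for j
    using defects[of j] unfolding tauberian_defect_def in_bidual_balls_def by auto
  have "\<forall>j. \<exists>f. f \<in> normed.dual \<and> normed.dual_norm f \<le> 1 \<and> 1/2 < \<bar>\<Phi> j f - f (u j)\<bar>"
    using far by blast
  then obtain f where f: "\<And>j. f j \<in> normed.dual" "\<And>j. normed.dual_norm (f j) \<le> 1"
    and f_far: "\<And>j. 1/2 < \<bar>\<Phi> j (f j) - f j (u j)\<bar>"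
    by metis
  define g where "g j = (\<lambda>x. sgn (\<Phi> j (f j) - f j (u j)) * f j x)" for j
  have g_dual: "g j \<in> normed.dual" for j
    unfolding g_def by (rule normed.dual_closed_scale[OF f(1)])
  have g_norm: "normed.dual_norm (g j) \<le> 1" for j
    using normed.dual_norm_scale[OF f(1)] f(2)[of j] normed.dual_norm_nonneg[OF f(1)]
    by (simp add: g_def abs_sgn_eq mult_le_one)
  have gap: "g j (u j) + 1/2 \<le> \<Phi> j (g j)" for j
  proof -
    have "\<Phi> j (g j) - g j (u j) = sgn (\<Phi> j (f j) - f j (u j)) * (\<Phi> j (f j) - f j (u j))"
      using normed.bidual_scale[OF \<Phi>(1) f(1)] by (simp add: g_def right_diff_distrib)
    also have "\<dots> = \<bar>\<Phi> j (f j) - f j (u j)\<bar>" by (simp add: sgn_if)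
    finally show ?thesis using f_far[of j] by simp
  qed
  have bound: "\<bar>\<Phi> j (g j)\<bar> \<le> 2" for j
    using \<Phi>(2)[OF g_dual[of j], of j] g_norm[of j] by linarith
  have "bounded_dual_family g" using g_dual g_norm by (auto simp: bounded_dual_family_def)
  then show ?thesis using bound gap by blast
qed

section \<open>The ultrapower of an operator that is not strongly Tauberian\<close>

context
  fixes U :: "nat filter"
  assumes U: "free_ultrafilter_nat U"
begin

interpretation UP: bounded_operator "linf :: (nat \<Rightarrow> 'a) set" seq_add seq_scale "unorm U"
  "linf :: (nat \<Rightarrow> 'b) set" seq_add seq_scale "unorm U" "\<lambda>x j. T (x j)" "onorm T"
  by (rule bounded_operator_ultrapower[OF U T])

text \<open>The functional \<open>ulimit g + T\<^sub>U\<^sup>* h\<close> is sampled at a sequence of approximants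
  \<open>x\<^sub>j\<close> of \<open>\<Phi>\<^sub>j\<close>: the first summand sees \<open>\<Phi>\<^sub>j (g\<^sub>j)\<close>, the second sees \<open>h W\<close> because
  \<open>T x\<^sub>j - W\<^sub>j \<rightarrow> 0\<close>.\<close>

lemma defect_extension_bound:
  assumes defects: "\<And>j. tauberian_defect (1 / (real j + 1)) (\<Phi> j) (W j)" and W: "W \<in> linf"
    and g: "bounded_dual_family g" and h: "h \<in> UP.Y.dual"
  shows "Lim U (\<lambda>j. \<Phi> j (g j)) + h W
    \<le> 3 * UP.X.dual_norm (\<lambda>x. ulimit_functional U g x + UP.adj h x)"
proof (rule field_le_epsilon)
  fix \<epsilon> :: real assume \<epsilon>: "0 < \<epsilon>"
  define F where "F = (\<lambda>x. ulimit_functional U g x + UP.adj h x)"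
  have F: "F \<in> UP.X.dual"
    unfolding F_def
      by (rule UP.X.dual_closed_add[OF ulimit_functional_in_dual[OF U g] UP.adj_in_dual[OF h]])
  obtain B where gD: "\<And>j. g j \<in> normed.dual" and B: "\<And>j. normed.dual_norm (g j) \<le> B"
    using g unfolding bounded_dual_family_def by blast
  have "\<forall>j. \<exists>x. norm x \<le> 3 \<and> norm (T x - W j) \<le> 2 / (real j + 1) \<and> \<bar>g j x - \<Phi> j (g j)\<bar> < \<epsilon>"
    using defect_local_approximation[OF defects gD \<epsilon>] by blast
  then obtain X where X: "\<And>j. norm (X j) \<le> 3" "\<And>j. norm (T (X j) - W j) \<le> 2 / (real j + 1)"
    "\<And>j. \<bar>g j (X j) - \<Phi> j (g j)\<bar> < \<epsilon>" by metis
  have X_linf: "X \<in> linf" using X(1) linf_iff by blast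
  have "F X \<le> UP.X.dual_norm F * unorm U X" using UP.X.dual_norm_bound[OF F X_linf] by simp
  also have "\<dots> \<le> 3 * UP.X.dual_norm F"
    using mult_left_mono[OF unorm_le_bound[OF U X_linf X(1)] UP.X.dual_norm_nonneg[OF F]]
    by (simp add: mult.commute)
  finally have FX: "F X \<le> 3 * UP.X.dual_norm F" .
  have TX_linf: "(\<lambda>j. T (X j)) \<in> linf" by (rule UP.T_closed[OF X_linf])
  define Z where "Z = seq_add (\<lambda>j. T (X j)) (seq_scale (-1) W)"
  have Z_linf: "Z \<in> linf" unfolding Z_def by (intro linf_seq_add linf_seq_scale TX_linf W)
  have "unorm U Z = 0"
    by (rule unorm_eq_0_vanishing[OF U Z_linf])
      (use X(2) in \<open>simp add: Z_def seq_add_def seq_scale_def\<close>)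
  then have "h Z = 0" using UP.Y.dual_norm_bound[OF h Z_linf] by simp
  moreover have "h Z = h (\<lambda>j. T (X j)) - h W"
    unfolding Z_def
      using UP.Y.dual_add[OF h TX_linf linf_seq_scale[OF W]] UP.Y.dual_scale[OF h W, of "-1"]
    by simp
  ultimately have hTX: "h (\<lambda>j. T (X j)) = h W" by simp
  obtain M where M: "\<And>j. \<bar>g j (X j)\<bar> \<le> M" using bounded_dual_family_apply[OF g X_linf] by metis
  have \<Phi>_bound: "\<bar>\<Phi> j (g j)\<bar> \<le> 2 * B" for j
    using defects[of j] gD[of j] B[of j]
      unfolding tauberian_defect_def in_bidual_balls_def by fastforce
  have "Lim U (\<lambda>j. \<Phi> j (g j)) \<le> Lim U (\<lambda>j. g j (X j) + \<epsilon>)"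
  proof (rule Lim_free_ultrafilter_nat_mono[OF U, of _ "2 * B" _ "M + \<epsilon>"])
    fix j
    show "\<bar>\<Phi> j (g j)\<bar> \<le> 2 * B" by (rule \<Phi>_bound)
    show "\<bar>g j (X j) + \<epsilon>\<bar> \<le> M + \<epsilon>" using M[of j] \<epsilon> by linarith
    show "\<Phi> j (g j) \<le> g j (X j) + \<epsilon>" using X(3)[of j] by linarith
  qed
  also have "\<dots> = Lim U (\<lambda>j. g j (X j)) + \<epsilon>"
    using Lim_free_ultrafilter_nat_add[OF U, of "\<lambda>j. g j (X j)" M "\<lambda>j. \<epsilon>" \<epsilon>] M \<epsilon>
      Lim_free_ultrafilter_nat_const[OF U] by simp
  finally show "Lim U (\<lambda>j. \<Phi> j (g j)) + h W
      \<le> 3 * UP.X.dual_norm (\<lambda>x. ulimit_functional U g x + UP.adj h x) + \<epsilon>"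
    using FX hTX X_linf unfolding F_def by (simp add: ulimit_functional_def)
qed

lemma defect_points_linf:
  assumes "\<And>j. tauberian_defect (1 / (real j + 1)) (\<Phi> j) (W j)"
  shows "W \<in> linf"
  using norm_defect_point_le[OF assms] linf_iff by blast

lemma defect_extension:
  assumes defects: "\<And>j. tauberian_defect (1 / (real j + 1)) (\<Phi> j) (W j)"
  obtains \<Psi> where "\<Psi> \<in> UP.X.bidual"
    and "\<And>g h. bounded_dual_family g \<Longrightarrow> h \<in> UP.Y.dual \<Longrightarrow>
      \<Psi> (\<lambda>x. ulimit_functional U g x + UP.adj h x) = Lim U (\<lambda>j. \<Phi> j (g j)) + h W"
proof -
  have W: "W \<in> linf" by (rule defect_points_linf[OF defects])
  have \<Phi>: "\<Phi> j \<in> normed.bidual" "\<And>f. f \<in> normed.dual \<Longrightarrow> \<bar>\<Phi> j f\<bar> \<le> 2 * normed.dual_norm f" for j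
    using defects[of j] unfolding tauberian_defect_def in_bidual_balls_def by auto
  define L where "L = Collect (bounded_dual_family :: (nat \<Rightarrow> 'a \<Rightarrow> real) \<Rightarrow> bool) \<times> UP.Y.dual"
  define ell where "ell z = ulimit_functional U (fst z) + UP.adj (snd z)"
    for z :: "(nat \<Rightarrow> 'a \<Rightarrow> real) \<times> ((nat \<Rightarrow> 'b) \<Rightarrow> real)"
  define phi where "phi z = Lim U (\<lambda>j. \<Phi> j (fst z j)) + snd z W"
    for z :: "(nat \<Rightarrow> 'a \<Rightarrow> real) \<times> ((nat \<Rightarrow> 'b) \<Rightarrow> real)"
  have ell_eq: "ell (g, h) = (\<lambda>x. ulimit_functional U g x + UP.adj h x)" for g h
    unfolding ell_def plus_fun_def fst_conv snd_conv ..
  have L: "subspace L"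
    unfolding L_def by (rule subspace_Times[OF subspace_bounded_dual_family UP.Y.subspace_dual])
  have ell: "linear_on L ell"
    unfolding L_def ell_def
    by (rule linear_on_Times[OF linear_on_ulimit_functional[OF U] UP.linear_on_adj])
  have phi: "linear_on L phi"
    unfolding L_def phi_def
    by (rule linear_on_Times[OF linear_on_Lim_bidual_family[OF U \<Phi>] linear_on_evaluation])
  have ell_dual: "ell ` L \<subseteq> UP.X.dual"
    using UP.X.dual_closed_add[OF ulimit_functional_in_dual[OF U] UP.adj_in_dual]
    by (auto simp: L_def ell_eq)
  have dom: "phi z \<le> 3 * UP.X.dual_norm (ell z)" if "z \<in> L" for z
    using defect_extension_bound[OF defects W] that by (auto simp: L_def phi_def ell_eq)
  have p: "sublinear_on UP.X.dual (\<lambda>F. 3 * UP.X.dual_norm F)"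
    by (rule sublinear_on_scale[OF UP.X.sublinear_on_dual_norm]) simp
  obtain \<Psi> where \<Psi>: "linear_on UP.X.dual \<Psi>" and \<Psi>_ell: "\<And>z. z \<in> L \<Longrightarrow> \<Psi> (ell z) = phi z"
    and \<Psi>_le: "\<And>F. F \<in> UP.X.dual \<Longrightarrow> \<Psi> F \<le> 3 * UP.X.dual_norm F"
    using hahn_banach_image[OF UP.X.subspace_dual L ell ell_dual phi p, of thesis] dom by blast
  show ?thesis
  proof
    show "(\<lambda>F. if F \<in> UP.X.dual then \<Psi> F else 0) \<in> UP.X.bidual"
      by (rule UP.X.bidual_of_dominated[OF \<Psi> \<Psi>_le])
    fix g :: "nat \<Rightarrow> 'a \<Rightarrow> real" and h assume "bounded_dual_family g" "h \<in> UP.Y.dual"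
    then have "(g, h) \<in> L" by (simp add: L_def)
    then show "(\<lambda>F. if F \<in> UP.X.dual then \<Psi> F else 0) (\<lambda>x. ulimit_functional U g x + UP.adj h x)
        = Lim U (\<lambda>j. \<Phi> j (g j)) + h W"
      using ell_dual \<Psi>_ell[of "(g, h)"] by (auto simp: phi_def ell_eq)
  qed
qed

lemma defect_extension_biadj:
  assumes defects: "\<And>j. tauberian_defect (1 / (real j + 1)) (\<Phi> j) (W j)"
    and \<Psi>_eq: "\<And>g h. bounded_dual_family g \<Longrightarrow> h \<in> UP.Y.dual \<Longrightarrow>
      \<Psi> (\<lambda>x. ulimit_functional U g x + UP.adj h x) = Lim U (\<lambda>j. \<Phi> j (g j)) + h W"
  shows "UP.biadj \<Psi> = UP.Y.canon W"
proof
  fix h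
  show "UP.biadj \<Psi> h = UP.Y.canon W h"
  proof (cases "h \<in> UP.Y.dual")
    case True
    have "ulimit_functional U (\<lambda>j (x :: 'a). 0) = (\<lambda>x. 0)"
      using Lim_free_ultrafilter_nat_const[OF U, of "0::real"]
      by (simp add: ulimit_functional_def fun_eq_iff)
    then have "UP.biadj \<Psi> h = \<Psi> (\<lambda>x. ulimit_functional U (\<lambda>j x. 0) x + UP.adj h x)"
      using UP.biadj_apply[OF True] by simp
    also have "\<dots> = h W"
    proof -
      have "\<Phi> j \<in> normed.bidual" for j
        using defects[of j] by (simp add: tauberian_defect_def in_bidual_balls_def)
      then have "\<Phi> j (\<lambda>x. 0) = 0" for j by (rule normed.bidual_zero)
      then show ?thesis
        using \<Psi>_eq[OF bounded_dual_family_zero True]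
          Lim_free_ultrafilter_nat_const[OF U, of "0::real"]
        by simp
    qed
    finally show ?thesis using UP.Y.canon_apply[OF True] by simp
  next
    case False
    then show ?thesis using UP.biadj_outside[OF False] by (simp add: scanon_def)
  qed
qed

text \<open>Tested against \<open>ulimit g\<close> for the family \<open>g\<close> of \<open>defect_separating_family\<close>, \<open>\<Psi>\<close>
  stays at distance \<open>1/2\<close> from every point of \<open>X\<^sub>U\<close>.\<close>

lemma defect_extension_not_canon:
  assumes defects: "\<And>j. tauberian_defect (1 / (real j + 1)) (\<Phi> j) (W j)"
    and \<Psi>_eq: "\<And>g h. bounded_dual_family g \<Longrightarrow> h \<in> UP.Y.dual \<Longrightarrow>
      \<Psi> (\<lambda>x. ulimit_functional U g x + UP.adj h x) = Lim U (\<lambda>j. \<Phi> j (g j)) + h W"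
    and u: "u \<in> linf"
  shows "\<Psi> \<noteq> UP.X.canon u"
proof
  assume \<Psi>_u: "\<Psi> = UP.X.canon u"
  obtain g where g: "bounded_dual_family g" and \<Phi>_g: "\<And>j. \<bar>\<Phi> j (g j)\<bar> \<le> 2"
    and gap: "\<And>j. g j (u j) + 1/2 \<le> \<Phi> j (g j)"
    using defect_separating_family[where c = "\<lambda>j. 1 / (real j + 1)" and \<Phi> = \<Phi> and W = W
        and u = u, OF defects] by blast
  obtain M where M: "\<And>j. \<bar>g j (u j)\<bar> \<le> M" using bounded_dual_family_apply[OF g u] by metis
  have "\<Psi> (ulimit_functional U g) = Lim U (\<lambda>j. \<Phi> j (g j))"
    using \<Psi>_eq[OF g UP.Y.dual_closed_zero] by simp
  moreover have "\<Psi> (ulimit_functional U g) = Lim U (\<lambda>j. g j (u j))"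
    using \<Psi>_u UP.X.canon_apply[OF ulimit_functional_in_dual[OF U g]] u
    by (simp add: ulimit_functional_def)
  moreover have "Lim U (\<lambda>j. g j (u j) + 1/2) \<le> Lim U (\<lambda>j. \<Phi> j (g j))"
  proof (rule Lim_free_ultrafilter_nat_mono[OF U, of _ "M + 1/2" _ 2])
    fix j
    show "\<bar>g j (u j) + 1/2\<bar> \<le> M + 1/2" using M[of j] by linarith
    show "\<bar>\<Phi> j (g j)\<bar> \<le> 2" by (rule \<Phi>_g)
    show "g j (u j) + 1/2 \<le> \<Phi> j (g j)" by (rule gap)
  qed
  moreover have "Lim U (\<lambda>j. g j (u j) + 1/2) = Lim U (\<lambda>j. g j (u j)) + 1/2"
    using Lim_free_ultrafilter_nat_add[OF U, of "\<lambda>j. g j (u j)" M "\<lambda>j. 1/2" "1/2"] M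
      Lim_free_ultrafilter_nat_const[OF U, of "1/2 :: real"] by simp
  ultimately show False by simp
qed

lemma not_super_tauberian_of_defects:
  assumes defects: "\<And>j. tauberian_defect (1 / (real j + 1)) (\<Phi> j) (W j)"
  shows "\<not> super_tauberian_wrt U T"
proof -
  obtain \<Psi> where \<Psi>: "\<Psi> \<in> UP.X.bidual"
    and \<Psi>_eq: "\<And>g h. bounded_dual_family g \<Longrightarrow> h \<in> UP.Y.dual \<Longrightarrow>
      \<Psi> (\<lambda>x. ulimit_functional U g x + UP.adj h x) = Lim U (\<lambda>j. \<Phi> j (g j)) + h W"
    using defect_extension[OF defects] by blast
  have "UP.biadj \<Psi> \<in> UP.Y.canon ` linf"
    using defect_extension_biadj[OF defects \<Psi>_eq] defect_points_linf[OF defects] by blast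
  moreover have "\<Psi> \<notin> UP.X.canon ` linf"
    using defect_extension_not_canon[OF defects \<Psi>_eq] by blast
  ultimately show ?thesis
    unfolding super_tauberian_wrt_def stauberian_def using \<Psi> by blast
qed

end

end

theorem corollary24:
  fixes T :: "'a::banach \<Rightarrow> 'b::banach" and U :: "nat filter"
  assumes "bounded_linear T"
    and "free_ultrafilter_nat U"
    and "super_tauberian_wrt U T"
  shows "strongly_tauberian T"
proof (rule ccontr)
  assume "\<not> strongly_tauberian T"
  then have "\<forall>j. \<exists>\<Phi> w. tauberian_defect T (1 / (real j + 1)) \<Phi> w"
    using tauberian_defect_if_not_strongly_tauberian[OF assms(1)] by simp
  then obtain \<Phi> W where "\<And>j. tauberian_defect T (1 / (real j + 1)) (\<Phi> j) (W j)"
    by metis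
  then show False
    using not_super_tauberian_of_defects[OF assms(1,2)] assms(3) by blast
qed

end
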